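(* Let $\alpha,\beta>0$ with $\alpha\beta\le 1$. Let $g\in L^2(\mathbb{R})$ be a function with $g(x)=0$ for $x<0$, whose restriction to $[0,\infty)$ is stably decreasing, and such that $\lim_{x\to\alpha^-}g(x)>0$. Let $\Lambda=\{\lambda_n\}_{n\in\mathbb{Z}}\subset\mathbb{R}$ be such that for each $n\in\mathbb{Z}$ we have $0<\lambda_{n+1}-\lambda_n\le\alpha$, and such that for some $m\in\mathbb{N}$ and all $n\in\mathbb{Z}$ we have $\lambda_{n+m}-\lambda_n\ge 1$. Then the system $\mathcal{G}(g;\Lambda\times\beta\mathbb{Z})$ is a frame in $L^2(\mathbb{R})$.
   Context: A function $g:[0,\infty)\to[0,\infty)$ is called stably decreasing if for every $t>0$ there exists $q(t)$ with $0<q(t)<1$ such that $g(x)q(t)\ge g(x+t)$ for all $x\ge 0$. For $g\in L^2(\mathbb{R})$ and $t,\omega\in\mathbb{R}$ put $\pi_{t,\omega}g(x)=e^{2\pi i\omega x}g(x-t)$. For a discrete set $\Gamma\subset\mathbb{R}^2$ the generalized Gabor system is $\mathcal{G}(g;\Gamma)=\{\pi_{t,\omega}g\}_{(t,\omega)\in\Gamma}$. It is a frame in $L^2(\mathbb{R})$ if there are constants $A,B>0$ such that for all $h\in L^2(\mathbb{R})$, $A\|h\|^2\le\sum_{(t,\omega)\in\Gamma}|(h,\pi_{t,\omega}g)|^2\le B\|h\|^2$, where $(\cdot,\cdot)$ and $\|\cdot\|$ are the inner product and norm of $L^2(\mathbb{R})$. The notation $\lim_{x\to\alpha^-}$ denotes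 the left-hand limit. *)

theory Defs
  imports "HOL-Analysis.Analysis"
begin

text \<open>
  Elements of \<open>L\<^sup>2(\<real>)\<close> are represented by Lebesgue measurable functions; functions that agree
  almost everywhere are not identified.
\<close>

definition L2 :: "(real \<Rightarrow> complex) set" where
  "L2 = {f. f \<in> borel_measurable lebesgue \<and> integrable lebesgue (\<lambda>x. (cmod (f x))\<^sup>2)}"

definition L2_inner :: "(real \<Rightarrow> complex) \<Rightarrow> (real \<Rightarrow> complex) \<Rightarrow> complex" where
  "L2_inner f h = (LINT x|lebesgue. f x * cnj (h x))"

definition L2_norm :: "(real \<Rightarrow> complex) \<Rightarrow> real" where
  "L2_norm f = sqrt (LINT x|lebesgue. (cmod (f x))\<^sup>2)"

definition time_freq_shift :: "real \<times> real \<Rightarrow> (real \<Rightarrow> complex) \<Rightarrow> real \<Rightarrow> complex" where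
  "time_freq_shift = (\<lambda>(t, \<omega>) g x. exp (2 * of_real pi * \<i> * of_real \<omega> * of_real x) * g (x - t))"

text \<open>
  The Gabor system is the family \<open>time_freq_shift p g\<close> indexed by \<open>p \<in> \<Gamma>\<close>; the definition is
  meant for windows \<open>g \<in> L2\<close>.  Since \<open>infsum\<close> is \<open>0\<close> on a family that is not summable, summability
  (which is part of the upper frame bound) is required explicitly.
\<close>

definition gabor_frame :: "(real \<Rightarrow> complex) \<Rightarrow> (real \<times> real) set \<Rightarrow> bool" where
  "gabor_frame g \<Gamma> \<longleftrightarrow>
    (\<exists>A>0. \<exists>B>0. \<forall>h\<in>L2.
       (\<lambda>p. (cmod (L2_inner h (time_freq_shift p g)))\<^sup>2) summable_on \<Gamma> \<and>
       A * (L2_norm h)\<^sup>2 \<le> (\<Sum>\<^sub>\<infinity>p\<in>\<Gamma>. (cmod (L2_inner h (time_freq_shift p g)))\<^sup>2) \<and>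
       (\<Sum>\<^sub>\<infinity>p\<in>\<Gamma>. (cmod (L2_inner h (time_freq_shift p g)))\<^sup>2) \<le> B * (L2_norm h)\<^sup>2)"

text \<open>This only concerns the restriction of \<open>g\<close> to \<open>[0, \<infinity>)\<close>, which has to map into \<open>[0, \<infinity>)\<close>.\<close>

definition stably_decreasing :: "(real \<Rightarrow> real) \<Rightarrow> bool" where
  "stably_decreasing g \<longleftrightarrow>
    (\<forall>x\<ge>0. g x \<ge> 0) \<and>
    (\<forall>t>0. \<exists>q. 0 < q \<and> q < 1 \<and> (\<forall>x\<ge>0. g x * q \<ge> g (x + t)))"

end

theory Submission imports Defs begin

text \<open>
  Put \<open>T = 1 / \<beta>\<close>, so that \<open>\<alpha> \<le> T\<close>.  For a fixed time shift \<open>\<lambda>\<close>, the coefficients of \<open>h\<close> against the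
  modulations by multiples of \<open>\<beta>\<close> are the Fourier coefficients of the \<open>T\<close>-periodic function
  \<open>x \<mapsto> \<Sum>\<^sub>j h (x + j T) g (x + j T - \<lambda>)\<close>.  By Parseval's identity (\<open>parseval\<close>, \<open>gabor_energy_eq_fibers\<close>)
  the frame inequality for all \<open>h\<close> follows once the matrices \<open>g (x + j T - \<lambda>\<^sub>n)\<close> with rows \<open>n\<close> and columns
  \<open>j\<close> are bounded above and below on \<open>\<ell>\<^sup>2(\<int>)\<close>, uniformly in \<open>x\<close>.

  The upper bound (\<open>analysis_upper_bound\<close>) is Schur's test: a stably decreasing window decays
  geometrically, and both the points \<open>x + j T\<close> and the points \<open>\<lambda>\<^sub>n\<close> have bounded density.

  The lower bound (\<open>analysis_lower_bound\<close>) uses only the rows belonging to the last point \<open>\<lambda>\<^sub>n\<close> before each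
  \<open>x + j T\<close>.  Because the gaps of \<open>\<Lambda>\<close> do not exceed \<open>T\<close>, these rows form a triangular matrix whose
  diagonal is bounded away from zero by the left limit of \<open>g\<close> at \<open>\<alpha>\<close>.  A triangular matrix with
  decaying entries need not be boundedly invertible; what helps is that \<open>g\<close> decreases.  Going
  from one row to the next, every nonzero entry past the diagonal grows, and by a definite factor
  unless the two chosen points are close, which cannot happen twice in succession.  As for polynomials with strictly
  decreasing coefficients, subtracting a multiple of the next row leaves a matrix dominated by its
  diagonal.  This is encoded in the inequality \<open>R\<^sub>j \<le> e\<^sub>j + q R\<^bsub>j+2\<^esub>\<close> with \<open>q < 1\<close> for
  the sums \<open>R\<^sub>j\<close> of absolute values along the rows, where \<open>e\<^sub>j\<close> is built from the row sums themselves.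
\<close>

section \<open>Sequences and matrices indexed by the integers\<close>

lemma iterated_gap:
  fixes p :: "int \<Rightarrow> real"
  assumes gap: "\<And>k. p k + s \<le> p (k + int m)"
  shows "p k + of_nat i * s \<le> p (k + int i * int m)"
proof (induction i)
  case (Suc i)
  have "p k + of_nat (Suc i) * s = (p k + of_nat i * s) + s" by (simp add: algebra_simps)
  also have "\<dots> \<le> p (k + int i * int m) + s" using Suc by simp
  also have "\<dots> \<le> p (k + int i * int m + int m)" by (rule gap)
  finally show ?case by (simp add: algebra_simps)
qed simp

text \<open>Used twice: to locate the last sampling point not after a given time, and to find the index at which
  the argument of the window becomes positive.\<close>

lemma exists_index_floor:
  fixes p :: "int \<Rightarrow> real"
  assumes gap: "\<And>k. p k + s \<le> p (k + int m)" and s: "s > 0"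
  shows "\<exists>n. p n \<le> y \<and> y < p (n + 1)"
proof -
  obtain i where i: "\<bar>y - p 0\<bar> / s < of_nat i" using reals_Archimedean2 by blast
  then have i': "\<bar>y - p 0\<bar> < of_nat i * s" using s by (simp add: field_simps)
  define a where "a = - (int i * int m)"
  have a: "p a \<le> y" using iterated_gap[of p s m a i, OF gap] i' by (simp add: a_def)
  have "y < p (a + int (2 * i * m))" using iterated_gap[of p s m 0 i, OF gap] i' by (simp add: a_def algebra_simps)
  then have ex: "\<exists>j::nat. y < p (a + int j)" by blast
  define l where "l = (LEAST j::nat. y < p (a + int j))"
  have l: "y < p (a + int l)" unfolding l_def by (rule LeastI_ex[OF ex])
  then have "l \<noteq> 0" using a by (intro notI) simp
  then obtain j where j: "l = Suc j" using not0_implies_Suc by blast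
  have "\<not> y < p (a + int j)"
    using not_less_Least[of j "\<lambda>j. y < p (a + int j)"] j unfolding l_def by linarith
  then show ?thesis using l j by (intro exI[of _ "a + int j"]) (simp add: algebra_simps)
qed

lemma nn_integral_count_space_inj_le:
  fixes f :: "'b \<Rightarrow> ennreal"
  assumes "inj \<phi>"
  shows "(\<integral>\<^sup>+j. f (\<phi> j) \<partial>count_space UNIV) \<le> (\<integral>\<^sup>+n. f n \<partial>count_space UNIV)"
proof -
  have "(\<integral>\<^sup>+j. f (\<phi> j) \<partial>count_space UNIV) = (\<integral>\<^sup>+n. f n \<partial>count_space (range \<phi>))"
    by (rule nn_integral_bij_count_space) (use assms in \<open>simp add: bij_betw_def\<close>)
  also have "\<dots> = (\<integral>\<^sup>+n. f n * indicator (range \<phi>) n \<partial>count_space UNIV)"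
    by (simp add: nn_integral_count_space_indicator)
  also have "\<dots> \<le> (\<integral>\<^sup>+n. f n \<partial>count_space UNIV)"
    by (rule nn_integral_mono) (simp add: indicator_def)
  finally show ?thesis .
qed

lemma nn_integral_count_space_shift:
  fixes f :: "int \<Rightarrow> ennreal"
  shows "(\<integral>\<^sup>+j. f (j + i) \<partial>count_space UNIV) = (\<integral>\<^sup>+j. f j \<partial>count_space UNIV)"
  by (rule nn_integral_bij_count_space) (simp add: bij_betw_def inj_def surj_plus_right)

text \<open>Splitting the kernel as \<open>sqrt K \<cdot> sqrt K\<close> and using Cauchy--Schwarz costs one row sum; exchanging the
  summations then costs one column sum.  The sequence \<open>a\<close> takes values in \<open>ennreal\<close>, so the lemma also
  yields the convergence of the inner sums for square-summable \<open>a\<close>.\<close>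

lemma schur_test:
  fixes K :: "int \<Rightarrow> int \<Rightarrow> real" and a :: "int \<Rightarrow> ennreal"
  assumes nn: "\<And>n k. K n k \<ge> 0"
    and row: "\<And>n. (\<integral>\<^sup>+k. ennreal (K n k) \<partial>count_space UNIV) \<le> C1"
    and col: "\<And>k. (\<integral>\<^sup>+n. ennreal (K n k) \<partial>count_space UNIV) \<le> C2"
  shows "(\<integral>\<^sup>+n. (\<integral>\<^sup>+k. a k * ennreal (K n k) \<partial>count_space UNIV)\<^sup>2 \<partial>count_space UNIV)
    \<le> C1 * C2 * (\<integral>\<^sup>+k. (a k)\<^sup>2 \<partial>count_space UNIV)"
proof -
  have sq: "ennreal (sqrt (K n k)) * ennreal (sqrt (K n k)) = ennreal (K n k)" for n k
    using nn[of n k] by (simp flip: ennreal_mult')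
  then have sq2: "(ennreal (sqrt (K n k)))\<^sup>2 = ennreal (K n k)" for n k
    by (simp only: power2_eq_square)
  have "(\<integral>\<^sup>+k. a k * ennreal (K n k) \<partial>count_space UNIV)\<^sup>2
     \<le> C1 * (\<integral>\<^sup>+k. ennreal (K n k) * (a k)\<^sup>2 \<partial>count_space UNIV)" for n
  proof -
    have "(\<integral>\<^sup>+k. a k * ennreal (K n k) \<partial>count_space UNIV)
        = (\<integral>\<^sup>+k. ennreal (sqrt (K n k)) * (ennreal (sqrt (K n k)) * a k) \<partial>count_space UNIV)"
      unfolding mult.assoc[symmetric] sq by (simp only: mult.commute)
    then have "(\<integral>\<^sup>+k. a k * ennreal (K n k) \<partial>count_space UNIV)\<^sup>2
       \<le> (\<integral>\<^sup>+k. (ennreal (sqrt (K n k)))\<^sup>2 \<partial>count_space UNIV)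
         * (\<integral>\<^sup>+k. (ennreal (sqrt (K n k)) * a k)\<^sup>2 \<partial>count_space UNIV)"
      using Cauchy_Schwarz_nn_integral[of "\<lambda>k. ennreal (sqrt (K n k))" "count_space UNIV"
        "\<lambda>k. ennreal (sqrt (K n k)) * a k"] by simp
    also have "\<dots> = (\<integral>\<^sup>+k. ennreal (K n k) \<partial>count_space UNIV)
         * (\<integral>\<^sup>+k. ennreal (K n k) * (a k)\<^sup>2 \<partial>count_space UNIV)"
      by (simp only: power_mult_distrib sq2)
    also have "\<dots> \<le> C1 * (\<integral>\<^sup>+k. ennreal (K n k) * (a k)\<^sup>2 \<partial>count_space UNIV)"
      by (intro mult_right_mono row) simp
    finally show ?thesis .
  qed
  then have "(\<integral>\<^sup>+n. (\<integral>\<^sup>+k. a k * ennreal (K n k) \<partial>count_space UNIV)\<^sup>2 \<partial>count_space UNIV)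
    \<le> (\<integral>\<^sup>+n. C1 * (\<integral>\<^sup>+k. ennreal (K n k) * (a k)\<^sup>2 \<partial>count_space UNIV) \<partial>count_space UNIV)"
    by (intro nn_integral_mono)
  also have "\<dots> = C1 * (\<integral>\<^sup>+n. (\<integral>\<^sup>+k. ennreal (K n k) * (a k)\<^sup>2 \<partial>count_space UNIV) \<partial>count_space UNIV)"
    by (simp add: nn_integral_cmult)
  also have "(\<integral>\<^sup>+n. (\<integral>\<^sup>+k. ennreal (K n k) * (a k)\<^sup>2 \<partial>count_space UNIV) \<partial>count_space UNIV)
    = (\<integral>\<^sup>+k. (\<integral>\<^sup>+n. ennreal (K n k) * (a k)\<^sup>2 \<partial>count_space UNIV) \<partial>count_space UNIV)"
    by (rule nn_integral_count_space_nn_integral) auto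
  also have "\<dots> = (\<integral>\<^sup>+k. (\<integral>\<^sup>+n. ennreal (K n k) \<partial>count_space UNIV) * (a k)\<^sup>2 \<partial>count_space UNIV)"
    by (simp add: nn_integral_multc)
  also have "\<dots> \<le> (\<integral>\<^sup>+k. C2 * (a k)\<^sup>2 \<partial>count_space UNIV)"
    by (intro nn_integral_mono mult_right_mono col) simp
  also have "\<dots> = C2 * (\<integral>\<^sup>+k. (a k)\<^sup>2 \<partial>count_space UNIV)"
    by (simp add: nn_integral_cmult)
  finally show ?thesis by (simp add: mult.assoc mult_left_mono)
qed

text \<open>
  The step that turns monotonicity into invertibility.  Away from the index \<open>j\<close> the sequence \<open>a\<close> is a
  damped copy of \<open>b\<close>, so \<open>|a k - r b k| = r |b k| - |a k|\<close> holds with equality there.  Subtracting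
  \<open>r\<close> times the sum of \<open>b\<close> from the sum of \<open>a\<close> and isolating \<open>a j\<close> therefore bounds \<open>|a j|\<close> by the two
  sums plus \<open>r \<Sum>|b| - \<Sum>\<^bsub>k\<noteq>j\<^esub> |a k|\<close>, and the last sum can be moved to the other side.  This is
  the argument of Enestrom and Kakeya on the zeros of polynomials with decreasing coefficients.\<close>

lemma l1_norm_comparison_step:
  fixes a b :: "int \<Rightarrow> complex" and \<sigma> :: "int \<Rightarrow> real"
  assumes inta: "integrable (count_space UNIV) a" and intb: "integrable (count_space UNIV) b"
    and eq: "\<And>k. k \<noteq> j \<Longrightarrow> a k = of_real (\<sigma> k) * b k \<and> 0 \<le> \<sigma> k \<and> \<sigma> k \<le> r"
    and bj: "b j = 0" and r: "r \<ge> 0"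
  shows "(LINT k|count_space UNIV. cmod (a k)) \<le> cmod (LINT k|count_space UNIV. a k)
      + r * cmod (LINT k|count_space UNIV. b k) + r * (LINT k|count_space UNIV. cmod (b k))"
proof -
  let ?M = "count_space (UNIV::int set)"
  define e where "e k = (if k = j then a j else 0)" for k
  have supp: "{k. e k \<noteq> 0} \<subseteq> {j}" by (auto simp: e_def)
  have fin: "finite {k. e k \<noteq> 0}" by (rule finite_subset[OF supp]) simp
  have e_ind: "e = (\<lambda>k. indicator {j} k *\<^sub>R a j)" by (auto simp: e_def indicator_def)
  have inte: "integrable ?M e"
    unfolding e_ind by (intro integrable_scaleR_left integrable_real_indicator) auto
  have Le: "(LINT k|?M. e k) = a j"
    by (subst lebesgue_integral_count_space_finite_support)
       (use fin in \<open>auto simp: e_def\<close>)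
  have inte': "integrable ?M (\<lambda>k. cmod (e k))" using inte by (rule integrable_norm)
  have "(\<lambda>k. cmod (e k)) = (\<lambda>k. indicator {j} k * cmod (a j))"
    by (auto simp: e_def indicator_def)
  then have Le': "(LINT k|?M. cmod (e k)) = cmod (a j)" by simp
  (* e removes the exceptional entry a j, so that the equality below holds for every k. *)
  have norm_d: "cmod (a k - of_real r * b k - e k) = r * cmod (b k) - cmod (a k) + cmod (e k)" for k
  proof (cases "k = j")
    case False
    then have "a k - of_real r * b k - e k = - (of_real (r - \<sigma> k) * b k)"
      using eq[of k] by (simp add: e_def algebra_simps)
    then have "cmod (a k - of_real r * b k - e k) = (r - \<sigma> k) * cmod (b k)"
      using eq[of k] False by (simp only: norm_minus_cancel norm_mult norm_of_real) simp
    also have "\<dots> = r * cmod (b k) - cmod (a k) + cmod (e k)"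
      using eq[of k] False by (simp add: e_def norm_mult algebra_simps)
    finally show ?thesis .
  qed (simp add: e_def bj)
  have "cmod (a j) - cmod (LINT k|?M. a k) - r * cmod (LINT k|?M. b k)
     \<le> cmod ((LINT k|?M. a k) - of_real r * (LINT k|?M. b k) - a j)"
  proof -
    have "cmod (a j) = cmod (((LINT k|?M. a k) - of_real r * (LINT k|?M. b k))
        - ((LINT k|?M. a k) - of_real r * (LINT k|?M. b k) - a j))" by simp
    also have "\<dots> \<le> cmod (LINT k|?M. a k) + cmod (of_real r * (LINT k|?M. b k))
       + cmod ((LINT k|?M. a k) - of_real r * (LINT k|?M. b k) - a j)"
      by (intro order_trans[OF norm_triangle_ineq4] add_right_mono norm_triangle_ineq4)
    finally show ?thesis using r by (simp add: norm_mult)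
  qed
  also have "(LINT k|?M. a k) - of_real r * (LINT k|?M. b k) - a j
      = (LINT k|?M. a k - of_real r * b k - e k)"
    using inta intb inte by (simp add: Le)
  also have "cmod \<dots> \<le> (LINT k|?M. cmod (a k - of_real r * b k - e k))"
    by (rule integral_norm_bound)
  also have "\<dots> = r * (LINT k|?M. cmod (b k)) - (LINT k|?M. cmod (a k)) + cmod (a j)"
    using inta intb inte' by (simp add: norm_d Le' integrable_norm)
  finally show ?thesis by simp
qed

section \<open>Stably decreasing windows\<close>

locale decreasing_window =
  fixes g :: "real \<Rightarrow> real"
  assumes stable: "stably_decreasing g" and zero_left: "\<And>x. x < 0 \<Longrightarrow> g x = 0"
begin

lemma window_nonneg [simp]: "g x \<ge> 0"
  using stable zero_left[of x] by (cases "x < 0") (auto simp: stably_decreasing_def)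

lemma window_ratio:
  assumes "t > 0"
  obtains q where "0 < q" "q < 1" "\<And>x. 0 \<le> x \<Longrightarrow> g (x + t) \<le> q * g x"
proof -
  have "\<exists>q. 0 < q \<and> q < 1 \<and> (\<forall>x\<ge>0. g x * q \<ge> g (x + t))"
    by (rule conjunct2[OF stable[unfolded stably_decreasing_def], rule_format, OF assms])
  then obtain q where "0 < q" "q < 1" "\<forall>x\<ge>0. g (x + t) \<le> q * g x"
    by (auto simp: mult.commute)
  then show ?thesis using that by blast
qed

lemma window_antimono:
  assumes xy: "0 \<le> x" "x \<le> y"
  shows "g y \<le> g x"
proof (cases "x = y")
  case False
  then have "y - x > 0" using xy by simp
  then obtain q where q: "0 < q" "q < 1" "\<And>x'. 0 \<le> x' \<Longrightarrow> g (x' + (y - x)) \<le> q * g x'"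
    by (rule window_ratio) blast
  have "g y \<le> q * g x" using q(3)[of x] xy by simp
  also have "\<dots> \<le> g x" using q by (simp add: mult_left_le_one_le)
  finally show ?thesis .
qed simp

lemma window_decay:
  assumes "t > 0"
  obtains q where "0 < q" "q < 1" "\<And>x y. 0 \<le> x \<Longrightarrow> x + t \<le> y \<Longrightarrow> g y \<le> q * g x"
proof -
  obtain q where q: "0 < q" "q < 1" "\<And>x. 0 \<le> x \<Longrightarrow> g (x + t) \<le> q * g x"
    using assms by (rule window_ratio) blast
  have "g y \<le> q * g x" if "0 \<le> x" "x + t \<le> y" for x y
    using window_antimono[of "x + t" y] q(3)[of x] that assms by simp
  with q(1,2) show ?thesis by (rule that)
qed

lemma window_le_at_0: "g x \<le> g 0"
  using window_antimono[of 0 x] zero_left[of x] by (cases "x < 0") auto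

lemma borel_measurable_window [measurable]: "g \<in> borel_measurable borel"
proof -
  have "mono (\<lambda>x. - g (max x 0))" by (intro monoI) (auto intro: window_antimono)
  then have "(\<lambda>x. - g (max x 0)) \<in> borel_measurable borel" by (rule borel_measurable_mono)
  then have "(\<lambda>x. - (- g (max x 0)) * indicator {0..} x) \<in> borel_measurable borel"
    by (intro borel_measurable_times borel_measurable_uminus) auto
  also have "(\<lambda>x. - (- g (max x 0)) * indicator {0..} x) = g"
    by (auto simp: fun_eq_iff indicator_def zero_left max_def)
  finally show ?thesis .
qed

text \<open>The window decays geometrically along every strictly increasing sequence of points that advances by
  \<open>s\<close> in each \<open>m\<close> steps.  The bound depends on \<open>s\<close> and \<open>m\<close> only: this uniformity over the sequences \<open>p\<close>
  makes the row and column sums of the sampling matrix bounded.\<close>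

lemma window_sum_bound:
  assumes s: "s > 0"
  obtains C :: real where "C > 0" and
    "\<And>p :: int \<Rightarrow> real. strict_mono p \<Longrightarrow> (\<And>k. p k + s \<le> p (k + int m)) \<Longrightarrow>
      (\<integral>\<^sup>+k. ennreal (g (p k)) \<partial>count_space UNIV) \<le> ennreal C"
proof -
  obtain q where q: "0 < q" "q < 1" and qd: "\<And>x y. 0 \<le> x \<Longrightarrow> x + s \<le> y \<Longrightarrow> g y \<le> q * g x"
    using window_decay[OF s] by blast
  (* One factor q for every m steps: rho is the factor per single step. *)
  define \<rho> where "\<rho> = root m q"
  define C where "C = g 0 / q\<^sup>2 / (1 - \<rho>) + 1"
  have pow: "g z \<le> q ^ N * g 0" if "of_nat N * s \<le> z" for N z
    using that
  proof (induction N arbitrary: z)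
    case 0 then show ?case by (simp add: window_le_at_0)
  next
    case (Suc N)
    then have "of_nat N * s \<le> z - s" by (simp add: algebra_simps)
    moreover have "0 \<le> of_nat N * s" using s by simp
    ultimately have "0 \<le> z - s" by linarith
    then have "g z \<le> q * g (z - s)" by (intro qd) simp_all
    also have "\<dots> \<le> q * (q ^ N * g 0)"
      using Suc.IH[of "z - s"] \<open>of_nat N * s \<le> z - s\<close> q by (intro mult_left_mono) auto
    finally show ?case by (simp add: mult.assoc)
  qed
  show ?thesis
  proof (cases "m = 0")
    case True
    show ?thesis
    proof (rule that[of 1])
      fix p :: "int \<Rightarrow> real" assume "\<And>k. p k + s \<le> p (k + int m)"
      from this[of 0] show "(\<integral>\<^sup>+k. ennreal (g (p k)) \<partial>count_space UNIV) \<le> ennreal 1"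
        using True s by simp
    qed simp
  next
    case False
    then have m: "m > 0" by simp
    have \<rho>: "0 < \<rho>" "\<rho> < 1" "\<rho> ^ m = q" using q m by (auto simp: \<rho>_def)
    have q_le: "q \<le> \<rho>" using power_decreasing[of 1 m \<rho>] \<rho> m by simp
    have "C > 0" using q \<rho> by (auto simp: C_def intro!: add_nonneg_pos divide_nonneg_nonneg)
    moreover have "(\<integral>\<^sup>+k. ennreal (g (p k)) \<partial>count_space UNIV) \<le> ennreal C"
      if p: "strict_mono p" and gap: "\<And>k. p k + s \<le> p (k + int m)" for p :: "int \<Rightarrow> real"
    proof -
      obtain n where n: "p n \<le> 0" "0 < p (n + 1)"
        using exists_index_floor[of p s m 0, OF gap s] by blast
      have bound: "g (p (n + int i)) \<le> g 0 / q\<^sup>2 * \<rho> ^ i" for i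
      proof (cases i)
        case 0
        have "q\<^sup>2 \<le> 1" using q by (simp add: power_le_one)
        then have "g 0 \<le> g 0 / q\<^sup>2" using q by (simp add: field_simps mult_left_le)
        then show ?thesis using 0 window_le_at_0[of "p n"] by simp
      next
        case (Suc a)
        define d where "d = a div m"
        have d: "d * m \<le> a" "a \<le> m * (d + 1)"
        proof -
          have "a = d * m + a mod m" "a mod m < m" "m * (d + 1) = d * m + m"
            using m by (auto simp: d_def)
          then show "d * m \<le> a" "a \<le> m * (d + 1)" by linarith+
        qed
        have "of_nat d * s \<le> p (n + 1 + int d * int m)" using iterated_gap[of p s m "n + 1" d, OF gap] n by simp
        also have "\<dots> \<le> p (n + int i)"
          using d(1) Suc by (intro strict_mono_leD[OF p]) (simp flip: of_nat_mult)
        finally have "g (p (n + int i)) \<le> q ^ d * g 0" by (rule pow)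
        also have "q ^ d \<le> \<rho> ^ a / q"
        proof -
          have "q ^ (d + 1) = \<rho> ^ (m * (d + 1))" by (simp only: power_mult \<rho>)
          also have "\<dots> \<le> \<rho> ^ a" using \<rho> d by (intro power_decreasing) auto
          finally show ?thesis using q by (simp add: field_simps)
        qed
        also have "\<rho> ^ a / q \<le> \<rho> ^ i / q\<^sup>2"
          using q q_le \<rho> Suc by (simp add: field_simps power2_eq_square)
        finally show ?thesis by (simp add: mult_right_mono mult.commute)
      qed
      have "(\<integral>\<^sup>+k. ennreal (g (p k)) \<partial>count_space UNIV) = (\<integral>\<^sup>+k. ennreal (g (p k)) \<partial>count_space {n..})"
      proof (rule nn_integral_count_space_eq)
        fix k assume "k \<in> UNIV - {n..}"
        then have "p k < p n" using p by (auto simp: strict_mono_less)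
        then show "ennreal (g (p k)) = 0" using n by (simp add: zero_left)
      qed auto
      also have "\<dots> = (\<integral>\<^sup>+i. ennreal (g (p (n + int i))) \<partial>count_space UNIV)"
      proof (rule nn_integral_bij_count_space[symmetric])
        show "bij_betw (\<lambda>i. n + int i) UNIV {n..}"
          by (rule bij_betw_byWitness[where f' = "\<lambda>k. nat (k - n)"]) auto
      qed
      also have "\<dots> \<le> (\<integral>\<^sup>+i. ennreal (g 0 / q\<^sup>2 * \<rho> ^ i) \<partial>count_space UNIV)"
        by (intro nn_integral_mono ennreal_leI bound)
      also have "\<dots> = (\<Sum>i. ennreal (g 0 / q\<^sup>2 * \<rho> ^ i))"
        by (simp add: nn_integral_count_space_nat)
      also have "\<dots> = ennreal (\<Sum>i. g 0 / q\<^sup>2 * \<rho> ^ i)"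
        using \<rho> q by (intro suminf_ennreal2) (auto intro!: summable_mult summable_geometric)
      also have "(\<Sum>i. g 0 / q\<^sup>2 * \<rho> ^ i) = g 0 / q\<^sup>2 / (1 - \<rho>)"
        using \<rho> by (subst suminf_mult) (auto intro!: summable_geometric simp: suminf_geometric)
      also have "ennreal \<dots> \<le> ennreal C" by (intro ennreal_leI) (simp add: C_def)
      finally show ?thesis .
    qed
    ultimately show ?thesis using that by blast
  qed
qed

section \<open>Bounds for the sampling matrix\<close>

lemma analysis_upper_bound:
  fixes \<Lambda> :: "int \<Rightarrow> real"
  assumes T: "T > 0" and mono: "strict_mono \<Lambda>" and gap: "\<And>n. \<Lambda> n + 1 \<le> \<Lambda> (n + int m)"
  obtains B :: real where "B > 0" and "\<And>x (a :: int \<Rightarrow> ennreal).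
    (\<integral>\<^sup>+n. (\<integral>\<^sup>+k. a k * ennreal (g (x + of_int k * T - \<Lambda> n)) \<partial>count_space UNIV)\<^sup>2 \<partial>count_space UNIV)
     \<le> ennreal B * (\<integral>\<^sup>+k. (a k)\<^sup>2 \<partial>count_space UNIV)"
proof -
  obtain C1 :: real where C1: "C1 > 0" and C1b:
    "\<And>p :: int \<Rightarrow> real. strict_mono p \<Longrightarrow> (\<And>k. p k + T \<le> p (k + int 1)) \<Longrightarrow>
      (\<integral>\<^sup>+k. ennreal (g (p k)) \<partial>count_space UNIV) \<le> ennreal C1"
    using window_sum_bound[OF T] by blast
  obtain C2 :: real where C2: "C2 > 0" and C2b:
    "\<And>p :: int \<Rightarrow> real. strict_mono p \<Longrightarrow> (\<And>k. p k + 1 \<le> p (k + int m)) \<Longrightarrow>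
      (\<integral>\<^sup>+k. ennreal (g (p k)) \<partial>count_space UNIV) \<le> ennreal C2"
    using window_sum_bound[of 1] by (metis zero_less_one)
  show ?thesis
  proof (rule that[of "C1 * C2"])
    show "C1 * C2 > 0" using C1 C2 by simp
    fix x and a :: "int \<Rightarrow> ennreal"
    have row: "(\<integral>\<^sup>+k. ennreal (g (x + of_int k * T - \<Lambda> n)) \<partial>count_space UNIV) \<le> ennreal C1" for n
      using T by (intro C1b strict_monoI) (auto simp: algebra_simps)
    have col: "(\<integral>\<^sup>+n. ennreal (g (x + of_int k * T - \<Lambda> n)) \<partial>count_space UNIV) \<le> ennreal C2" for k
    proof -
      have "(\<integral>\<^sup>+n. ennreal (g (x + of_int k * T - \<Lambda> n)) \<partial>count_space UNIV)
         = (\<integral>\<^sup>+n. ennreal (g (x + of_int k * T - \<Lambda> (- n))) \<partial>count_space UNIV)"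
        by (rule nn_integral_bij_count_space[symmetric]) (rule bij_uminus)
      also have "\<dots> \<le> ennreal C2"
      proof (rule C2b)
        show "strict_mono (\<lambda>n. x + of_int k * T - \<Lambda> (- n))"
          by (intro strict_monoI) (simp add: strict_mono_less[OF mono])
        show "x + of_int k * T - \<Lambda> (- n) + 1 \<le> x + of_int k * T - \<Lambda> (- (n + int m))" for n
          using gap[of "- (n + int m)"] by simp
      qed
      finally show ?thesis .
    qed
    show "(\<integral>\<^sup>+n. (\<integral>\<^sup>+k. a k * ennreal (g (x + of_int k * T - \<Lambda> n)) \<partial>count_space UNIV)\<^sup>2 \<partial>count_space UNIV)
     \<le> ennreal (C1 * C2) * (\<integral>\<^sup>+k. (a k)\<^sup>2 \<partial>count_space UNIV)"
      using schur_test[of "\<lambda>n k. g (x + of_int k * T - \<Lambda> n)", OF window_nonneg row col] C1 C2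
      by (simp add: ennreal_mult)
  qed
qed

text \<open>
  Write \<open>y k = x + k T\<close> and let \<open>\<Lambda> (\<nu> j)\<close> be the last sampling point not after \<open>y j\<close>.  Since
  consecutive sampling points are at most \<open>\<alpha> \<le> T\<close> apart, \<open>\<Lambda> (\<nu> j)\<close> lies in \<open>(y (j - 1), y j]\<close>; hence the
  matrix \<open>g (y k - \<Lambda> (\<nu> j))\<close> is triangular with diagonal entries at least \<open>L\<close>.  Let \<open>R j\<close> be the sum of the
  absolute values \<open>|c k| g (y k - \<Lambda> (\<nu> j))\<close> and \<open>d j\<close> the sum without absolute values.  Passing from
  \<open>\<nu> j\<close> to \<open>\<nu> (j + 1)\<close> shortens all arguments of \<open>g\<close>, so the comparison step gives
  \<open>R j \<le> |d j| + r |d (j + 1)| + r R (j + 1)\<close> with \<open>r = 1\<close> always, and with a fixed \<open>r = q < 1\<close> if the two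
  sampling points are at least \<open>T / 2\<close> apart.  Two consecutive chosen points may be arbitrarily close,
  but \<open>\<Lambda> (\<nu> (j + 2)) - \<Lambda> (\<nu> j) \<ge> T\<close>, so the contraction happens in at least one of any two consecutive
  steps.  Squaring and summing, \<open>R\<close> is controlled by \<open>d\<close> in \<open>\<ell>\<^sup>2\<close>, and \<open>L |c j| \<le> R j\<close>.\<close>

lemma analysis_lower_bound:
  fixes \<Lambda> :: "int \<Rightarrow> real"
  assumes T: "T > 0" and \<alpha>: "\<alpha> \<le> T" and mono: "strict_mono \<Lambda>"
    and gap: "\<And>n. \<Lambda> n + 1 \<le> \<Lambda> (n + int m)" and dense: "\<And>n. \<Lambda> (n + 1) - \<Lambda> n \<le> \<alpha>"
    and L: "L > 0" and gL: "\<And>z. 0 \<le> z \<Longrightarrow> z < \<alpha> \<Longrightarrow> L \<le> g z"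
  obtains A :: real where "A > 0" and "\<And>x (c :: int \<Rightarrow> complex).
    (\<integral>\<^sup>+k. (ennreal (cmod (c k)))\<^sup>2 \<partial>count_space UNIV) < \<infinity> \<Longrightarrow>
    ennreal A * (\<integral>\<^sup>+k. (ennreal (cmod (c k)))\<^sup>2 \<partial>count_space UNIV)
    \<le> (\<integral>\<^sup>+n. (ennreal (cmod (LINT k|count_space UNIV. c k * of_real (g (x + of_int k * T - \<Lambda> n)))))\<^sup>2 \<partial>count_space UNIV)"
proof -
  obtain q where q: "0 < q" "q < 1"
    and qd: "\<And>x y. 0 \<le> x \<Longrightarrow> x + T / 2 \<le> y \<Longrightarrow> g y \<le> q * g x"
    using window_decay[of "T / 2"] T by auto
  obtain B :: real where B: "B > 0" and Bb: "\<And>x (a :: int \<Rightarrow> ennreal).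
    (\<integral>\<^sup>+n. (\<integral>\<^sup>+k. a k * ennreal (g (x + of_int k * T - \<Lambda> n)) \<partial>count_space UNIV)\<^sup>2 \<partial>count_space UNIV)
     \<le> ennreal B * (\<integral>\<^sup>+k. (a k)\<^sup>2 \<partial>count_space UNIV)"
    using analysis_upper_bound[OF T mono gap] by blast
  (* The factor 18 is 3 (1 + 4 + 1), from the square of e j = |d j| + 2 |d (j + 1)| + |d (j + 2)|. *)
  show ?thesis
  proof (rule that[of "L\<^sup>2 * (1 - q)\<^sup>2 / 18"])
    show "L\<^sup>2 * (1 - q)\<^sup>2 / 18 > 0" using L q by simp
    fix x and c :: "int \<Rightarrow> complex"
    assume fin: "(\<integral>\<^sup>+k. (ennreal (cmod (c k)))\<^sup>2 \<partial>count_space UNIV) < \<infinity>"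
    let ?M = "count_space (UNIV :: int set)"
    let ?d = "\<lambda>n. LINT k|?M. c k * of_real (g (x + of_int k * T - \<Lambda> n))"
    define y where "y k = x + of_int k * T" for k :: int
    have y_mono: "y j + T \<le> y k" if "j < k" for j k
      using that T mult_right_mono[of "of_int (j + 1)" "of_int k" T] by (simp add: y_def algebra_simps)
    have "\<forall>j. \<exists>n. \<Lambda> n \<le> y j \<and> y j < \<Lambda> (n + 1)"
      using exists_index_floor[of \<Lambda> 1 m, OF gap] by simp
    then obtain \<nu> where \<nu>: "\<And>j. \<Lambda> (\<nu> j) \<le> y j" "\<And>j. y j < \<Lambda> (\<nu> j + 1)"
      by metis
    have near: "y j - \<Lambda> (\<nu> j) < \<alpha>" for j using \<nu>(2)[of j] dense[of "\<nu> j"] by linarith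
    have ahead: "y j < \<Lambda> (\<nu> k)" if "j < k" for j k
      using y_mono[OF that] near[of k] \<alpha> by linarith
    have "strict_mono \<nu>"
    proof (rule strict_monoI)
      fix j k :: int assume "j < k"
      then have "\<Lambda> (\<nu> j) < \<Lambda> (\<nu> k)" using ahead[of j k] \<nu>(1)[of j] by linarith
      then show "\<nu> j < \<nu> k" using strict_mono_less[OF mono] by blast
    qed
    then have inj: "inj \<nu>" by (rule strict_mono_imp_inj_on)
    define a where "a j k = c k * of_real (g (y k - \<Lambda> (\<nu> j)))" for j k
    define d where "d j = (LINT k|?M. a j k)" for j
    define R where "R j = (LINT k|?M. cmod (a j k))" for j
    have d_eq: "d j = ?d (\<nu> j)" for j by (simp add: d_def a_def y_def)
    have ennR0: "(\<integral>\<^sup>+k. ennreal (cmod (a j k)) \<partial>?M)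
        = (\<integral>\<^sup>+k. ennreal (cmod (c k)) * ennreal (g (x + of_int k * T - \<Lambda> (\<nu> j))) \<partial>?M)" for j
      by (simp add: a_def y_def norm_mult ennreal_mult)
    have "(\<integral>\<^sup>+j. (\<integral>\<^sup>+k. ennreal (cmod (a j k)) \<partial>?M)\<^sup>2 \<partial>?M)
        \<le> (\<integral>\<^sup>+n. (\<integral>\<^sup>+k. ennreal (cmod (c k)) * ennreal (g (x + of_int k * T - \<Lambda> n)) \<partial>?M)\<^sup>2 \<partial>?M)"
      unfolding ennR0 by (rule nn_integral_count_space_inj_le[OF inj])
    also have "\<dots> \<le> ennreal B * (\<integral>\<^sup>+k. (ennreal (cmod (c k)))\<^sup>2 \<partial>?M)" by (rule Bb)
    also have "\<dots> < \<infinity>" using fin by (simp add: ennreal_mult_less_top)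
    finally have finR: "(\<integral>\<^sup>+j. (\<integral>\<^sup>+k. ennreal (cmod (a j k)) \<partial>?M)\<^sup>2 \<partial>?M) < \<infinity>" .
    have finR1: "(\<integral>\<^sup>+k. ennreal (cmod (a j k)) \<partial>?M) < \<infinity>" for j
    proof -
      have "(\<integral>\<^sup>+k. ennreal (cmod (a j k)) \<partial>?M)\<^sup>2 < \<infinity>"
        by (rule le_less_trans[OF nn_integral_ge_point finR]) simp
      then show ?thesis by (simp add: power_less_top_ennreal)
    qed
    have int: "integrable ?M (a j)" for j
      using finR1[of j] by (simp add: integrable_iff_bounded)
    have ennR: "(\<integral>\<^sup>+k. ennreal (cmod (a j k)) \<partial>?M) = ennreal (R j)" for j
      unfolding R_def by (rule nn_integral_eq_integral) (use int in \<open>auto intro: integrable_norm\<close>)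
    have R_nonneg: "R j \<ge> 0" for j by (simp add: R_def)
    have step: "R j \<le> cmod (d j) + r * cmod (d (j + 1)) + r * R (j + 1)"
      if r: "0 \<le> r" and le: "\<And>k. j < k \<Longrightarrow> g (y k - \<Lambda> (\<nu> j)) \<le> r * g (y k - \<Lambda> (\<nu> (j + 1)))" for j r
      unfolding R_def d_def
    proof (rule l1_norm_comparison_step[OF int int, where j = j and
          \<sigma> = "\<lambda>k. if g (y k - \<Lambda> (\<nu> (j + 1))) = 0 then 0 else g (y k - \<Lambda> (\<nu> j)) / g (y k - \<Lambda> (\<nu> (j + 1)))"])
      show "a (j + 1) j = 0" using ahead[of j "j + 1"] by (simp add: a_def zero_left)
      fix k assume "k \<noteq> j"
      show "a j k = complex_of_real (if g (y k - \<Lambda> (\<nu> (j + 1))) = 0 then 0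
            else g (y k - \<Lambda> (\<nu> j)) / g (y k - \<Lambda> (\<nu> (j + 1)))) * a (j + 1) k \<and>
          0 \<le> (if g (y k - \<Lambda> (\<nu> (j + 1))) = 0 then 0
            else g (y k - \<Lambda> (\<nu> j)) / g (y k - \<Lambda> (\<nu> (j + 1)))) \<and>
          (if g (y k - \<Lambda> (\<nu> (j + 1))) = 0 then 0
            else g (y k - \<Lambda> (\<nu> j)) / g (y k - \<Lambda> (\<nu> (j + 1)))) \<le> r"
      proof (cases "k < j")
        case True
        then have "g (y k - \<Lambda> (\<nu> j)) = 0" "g (y k - \<Lambda> (\<nu> (j + 1))) = 0"
          using ahead[of k j] ahead[of k "j + 1"] by (auto simp: zero_left)
        then show ?thesis using r by (simp add: a_def)
      next
        case False
        then have "j < k" using \<open>k \<noteq> j\<close> by simp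
        note le = le[OF this]
        show ?thesis
        proof (cases "g (y k - \<Lambda> (\<nu> (j + 1))) = 0")
          case True
          then have "g (y k - \<Lambda> (\<nu> j)) = 0"
            using le window_nonneg[of "y k - \<Lambda> (\<nu> j)"] by simp
          then show ?thesis using True r by (simp add: a_def)
        next
          case False
          then have "g (y k - \<Lambda> (\<nu> (j + 1))) > 0"
            using window_nonneg[of "y k - \<Lambda> (\<nu> (j + 1))"] by linarith
          then show ?thesis using le by (simp add: a_def field_simps)
        qed
      qed
    qed (use r in simp)
    have behind: "0 \<le> y k - \<Lambda> (\<nu> (j + 1))" if "j < k" for j k
      using \<nu>(1)[of "j + 1"] y_mono[of "j + 1" k] T that by (cases "k = j + 1") auto
    have \<nu>_less: "\<Lambda> (\<nu> j) < \<Lambda> (\<nu> (j + 1))" for j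
      using \<nu>(1)[of j] ahead[of j "j + 1"] by simp
    have step1: "R j \<le> cmod (d j) + cmod (d (j + 1)) + R (j + 1)" for j
    proof -
      have "g (y k - \<Lambda> (\<nu> j)) \<le> 1 * g (y k - \<Lambda> (\<nu> (j + 1)))" if "j < k" for k
        using window_antimono[OF behind[OF that]] \<nu>_less[of j] by simp
      from step[of 1, OF _ this] show ?thesis by simp
    qed
    have stepq: "R j \<le> cmod (d j) + cmod (d (j + 1)) + q * R (j + 1)"
      if far: "\<Lambda> (\<nu> j) + T / 2 \<le> \<Lambda> (\<nu> (j + 1))" for j
    proof -
      have "g (y k - \<Lambda> (\<nu> j)) \<le> q * g (y k - \<Lambda> (\<nu> (j + 1)))" if "j < k" for k
        using qd[OF behind[OF that]] far by simp
      from step[of q, OF _ this] have "R j \<le> cmod (d j) + q * cmod (d (j + 1)) + q * R (j + 1)"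
        using q by simp
      moreover have "q * cmod (d (j + 1)) \<le> cmod (d (j + 1))" using q by (simp add: mult_left_le_one_le)
      ultimately show ?thesis by linarith
    qed
    define e where "e j = cmod (d j) + 2 * cmod (d (j + 1)) + cmod (d (j + 2))" for j
    have two_steps: "R j \<le> e j + q * R (j + 2)" for j
    proof -
      have j2: "j + 1 + 1 = j + 2" by simp
      have far: "\<Lambda> (\<nu> j) + T \<le> \<Lambda> (\<nu> (j + 2))"
        using \<nu>(1)[of j] y_mono[of j "j + 1"] ahead[of "j + 1" "j + 2"] by simp
      show ?thesis
      proof (cases "\<Lambda> (\<nu> j) + T / 2 \<le> \<Lambda> (\<nu> (j + 1))")
        case True
        have "q * R (j + 1) \<le> q * (cmod (d (j + 1)) + cmod (d (j + 2)) + R (j + 2))"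
          using step1[of "j + 1"] q by (intro mult_left_mono) (simp_all add: j2)
        also have "\<dots> = q * (cmod (d (j + 1)) + cmod (d (j + 2))) + q * R (j + 2)"
          by (simp add: algebra_simps)
        also have "\<dots> \<le> cmod (d (j + 1)) + cmod (d (j + 2)) + q * R (j + 2)"
          using q by (intro add_right_mono mult_left_le_one_le) auto
        finally show ?thesis using stepq[OF True] by (simp add: e_def)
      next
        case False
        then have "\<Lambda> (\<nu> (j + 1)) + T / 2 \<le> \<Lambda> (\<nu> (j + 1 + 1))" using far by (simp add: j2)
        from stepq[OF this] step1[of j] show ?thesis by (simp add: e_def j2)
      qed
    qed
    (* Convexity of the square: e + q R is the convex combination of e / (1 - q) and R. *)
    have sq: "(R j)\<^sup>2 \<le> (e j)\<^sup>2 / (1 - q) + q * (R (j + 2))\<^sup>2" for j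
    proof -
      have "(R j)\<^sup>2 \<le> (e j + q * R (j + 2))\<^sup>2"
        by (intro power_mono two_steps R_nonneg)
      also have "\<dots> \<le> (e j)\<^sup>2 / (1 - q) + q * (R (j + 2))\<^sup>2"
      proof -
        define u where "u = e j / (1 - q)"
        have e: "e j = (1 - q) * u" using q by (simp add: u_def)
        have "(1 - q) * u\<^sup>2 + q * (R (j + 2))\<^sup>2 - (e j + q * R (j + 2))\<^sup>2 = q * (1 - q) * (u - R (j + 2))\<^sup>2"
          unfolding e by (simp add: power2_eq_square algebra_simps)
        moreover have "0 \<le> q * (1 - q) * (u - R (j + 2))\<^sup>2" using q by simp
        moreover have "(e j)\<^sup>2 / (1 - q) = (1 - q) * u\<^sup>2" using q by (simp add: e power2_eq_square)
        ultimately show ?thesis by linarith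
      qed
      finally show ?thesis .
    qed
    define D where "D j = (ennreal (cmod (d j)))\<^sup>2" for j
    have e_sq: "ennreal ((e j)\<^sup>2) \<le> 3 * (D j + 4 * D (j + 1) + D (j + 2))" for j
    proof -
      have "(u + 2 * v + w)\<^sup>2 \<le> 3 * (u\<^sup>2 + 4 * v\<^sup>2 + w\<^sup>2)" for u v w :: real
      proof -
        have "3 * (u\<^sup>2 + 4 * v\<^sup>2 + w\<^sup>2) - (u + 2 * v + w)\<^sup>2
            = (u - 2 * v)\<^sup>2 + (2 * v - w)\<^sup>2 + (u - w)\<^sup>2"
          by (simp add: power2_eq_square algebra_simps)
        then show ?thesis by (metis diff_ge_0_iff_ge add_nonneg_nonneg zero_le_power2)
      qed
      then have "ennreal ((e j)\<^sup>2) \<le> ennreal (3 * ((cmod (d j))\<^sup>2 + 4 * (cmod (d (j + 1)))\<^sup>2 + (cmod (d (j + 2)))\<^sup>2))"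
        unfolding e_def by (rule ennreal_leI)
      also have "\<dots> = 3 * (D j + 4 * D (j + 1) + D (j + 2))"
        by (simp add: D_def ennreal_mult ennreal_plus ennreal_power)
      finally show ?thesis .
    qed
    define Y where "Y = (\<integral>\<^sup>+j. D j \<partial>?M)"
    define X where "X = (\<integral>\<^sup>+j. ennreal ((R j)\<^sup>2) \<partial>?M)"
    (* Finiteness of X, from the upper bound, allows the term q X to be absorbed below. *)
    have X_fin: "X < \<infinity>"
      using finR by (simp add: X_def ennR ennreal_power R_nonneg)
    have "(\<integral>\<^sup>+j. ennreal ((e j)\<^sup>2) \<partial>?M) \<le> (\<integral>\<^sup>+j. 3 * (D j + 4 * D (j + 1) + D (j + 2)) \<partial>?M)"
      by (intro nn_integral_mono e_sq)
    also have "\<dots> = 3 * (Y + 4 * (\<integral>\<^sup>+j. D (j + 1) \<partial>?M) + (\<integral>\<^sup>+j. D (j + 2) \<partial>?M))"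
      by (simp add: nn_integral_add nn_integral_cmult Y_def)
    also have "\<dots> = 18 * Y"
    proof -
      have "Y + 4 * Y + Y = (1 + 4 + 1) * Y" by (simp only: distrib_right mult_1)
      then have "Y + 4 * Y + Y = 6 * Y" by simp
      moreover have "3 * (6 * Y) = 18 * Y" by (simp flip: mult.assoc)
      ultimately show ?thesis by (simp add: nn_integral_count_space_shift Y_def)
    qed
    finally have E: "(\<integral>\<^sup>+j. ennreal ((e j)\<^sup>2) \<partial>?M) \<le> 18 * Y" .
    have "X \<le> (\<integral>\<^sup>+j. ennreal (1 / (1 - q)) * ennreal ((e j)\<^sup>2) + ennreal q * ennreal ((R (j + 2))\<^sup>2) \<partial>?M)"
      unfolding X_def
    proof (intro nn_integral_mono)
      fix j
      show "ennreal ((R j)\<^sup>2) \<le> ennreal (1 / (1 - q)) * ennreal ((e j)\<^sup>2) + ennreal q * ennreal ((R (j + 2))\<^sup>2)"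
        using ennreal_leI[OF sq[of j]] q by (simp flip: ennreal_mult ennreal_plus)
    qed
    also have "\<dots> = ennreal (1 / (1 - q)) * (\<integral>\<^sup>+j. ennreal ((e j)\<^sup>2) \<partial>?M) + ennreal q * X"
      by (simp add: nn_integral_add nn_integral_cmult X_def
          nn_integral_count_space_shift[of "\<lambda>j. ennreal ((R j)\<^sup>2)"])
    also have "\<dots> \<le> ennreal (1 / (1 - q)) * (18 * Y) + ennreal q * X"
      by (intro add_right_mono mult_left_mono E) simp
    finally have XY: "X \<le> ennreal (1 / (1 - q)) * (18 * Y) + ennreal q * X" .
    have XY': "ennreal ((1 - q)\<^sup>2 / 18) * X \<le> Y"
    proof (cases "Y = \<infinity>")
      case False
      obtain x' where x': "X = ennreal x'" "x' \<ge> 0" using X_fin by (cases X) auto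
      obtain y' where y': "Y = ennreal y'" "y' \<ge> 0" using False by (cases Y) auto
      define s where "s = 1 / (1 - q)"
      have s: "s \<ge> 0" using q by (simp add: s_def)
      have "ennreal x' \<le> ennreal (s * (18 * y') + q * x')"
        using XY x' y' q s by (simp add: ennreal_mult ennreal_plus flip: s_def)
      then have "x' \<le> s * (18 * y') + q * x'"
        using x' y' q s by (subst (asm) ennreal_le_iff) auto
      then have "(1 - q) * x' \<le> 18 * y' / (1 - q)" by (simp add: s_def algebra_simps)
      then have "(1 - q)\<^sup>2 / 18 * x' \<le> y'"
        using q by (simp add: field_simps power2_eq_square)
      then show ?thesis using x' y' q by (simp flip: ennreal_mult)
    qed simp
    have point: "L * cmod (c j) \<le> R j" for j
    proof -
      have "L * cmod (c j) \<le> g (y j - \<Lambda> (\<nu> j)) * cmod (c j)"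
        using gL[of "y j - \<Lambda> (\<nu> j)"] near[of j] \<nu>(1)[of j] by (intro mult_right_mono) auto
      also have "\<dots> = cmod (a j j)" by (simp add: a_def norm_mult)
      finally have "L * cmod (c j) \<le> cmod (a j j)" .
      moreover have "ennreal (cmod (a j j)) \<le> ennreal (R j)"
        unfolding ennR[symmetric] by (rule nn_integral_ge_point) simp
      ultimately show ?thesis using R_nonneg by (simp add: ennreal_le_iff)
    qed
    have "ennreal (L\<^sup>2) * (\<integral>\<^sup>+k. (ennreal (cmod (c k)))\<^sup>2 \<partial>?M) = (\<integral>\<^sup>+k. ennreal (L\<^sup>2) * (ennreal (cmod (c k)))\<^sup>2 \<partial>?M)"
      by (simp add: nn_integral_cmult)
    also have "\<dots> \<le> X"
      unfolding X_def
    proof (intro nn_integral_mono)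
      fix k
      have "(L * cmod (c k))\<^sup>2 \<le> (R k)\<^sup>2" using L by (intro power_mono point) auto
      then show "ennreal (L\<^sup>2) * (ennreal (cmod (c k)))\<^sup>2 \<le> ennreal ((R k)\<^sup>2)"
        by (simp add: power_mult_distrib ennreal_power flip: ennreal_mult)
    qed
    finally have "ennreal ((1 - q)\<^sup>2 / 18) * (ennreal (L\<^sup>2) * (\<integral>\<^sup>+k. (ennreal (cmod (c k)))\<^sup>2 \<partial>?M)) \<le> Y"
      using XY' by (meson mult_left_mono order_trans zero_le)
    also have "ennreal ((1 - q)\<^sup>2 / 18) * (ennreal (L\<^sup>2) * (\<integral>\<^sup>+k. (ennreal (cmod (c k)))\<^sup>2 \<partial>?M))
       = ennreal (L\<^sup>2 * (1 - q)\<^sup>2 / 18) * (\<integral>\<^sup>+k. (ennreal (cmod (c k)))\<^sup>2 \<partial>?M)"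
      by (simp add: mult.assoc[symmetric] mult.commute flip: ennreal_mult)
    also have "Y \<le> (\<integral>\<^sup>+n. (ennreal (cmod (?d n)))\<^sup>2 \<partial>?M)"
      unfolding Y_def D_def d_eq by (rule nn_integral_count_space_inj_le[OF inj])
    finally show "ennreal (L\<^sup>2 * (1 - q)\<^sup>2 / 18) * (\<integral>\<^sup>+k. (ennreal (cmod (c k)))\<^sup>2 \<partial>?M)
      \<le> (\<integral>\<^sup>+n. (ennreal (cmod (?d n)))\<^sup>2 \<partial>?M)" .
  qed
qed

end

section \<open>Harmonics of a given period\<close>

definition harmonic :: "real \<Rightarrow> int \<Rightarrow> real \<Rightarrow> complex" where
  "harmonic T k x = cis (2 * pi * of_int k * x / T)"

abbreviation period_measure :: "real \<Rightarrow> real measure" where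
  "period_measure T \<equiv> restrict_space lborel {0..<T}"

lemma norm_harmonic [simp]: "cmod (harmonic T k x) = 1"
  by (simp add: harmonic_def)

lemma harmonic_mult: "harmonic T k x * harmonic T l x = harmonic T (k + l) x"
  by (simp add: harmonic_def cis_mult add_divide_distrib algebra_simps)

lemma cnj_harmonic: "cnj (harmonic T k x) = harmonic T (- k) x"
  by (simp add: harmonic_def cis_cnj)

lemma continuous_on_harmonic [continuous_intros]: "continuous_on A (harmonic T k)"
  unfolding harmonic_def divide_inverse cis_conv_exp by (intro continuous_intros)

lemma borel_measurable_harmonic [measurable]: "harmonic T k \<in> borel_measurable borel"
  by (rule borel_measurable_continuous_onI) (rule continuous_on_harmonic)

lemma finite_measure_period: "finite_measure (period_measure T)"
  by (rule finite_measureI) (simp add: space_restrict_space emeasure_restrict_space, cases "0 \<le> T", auto)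

lemma borel_measurable_period: "f \<in> borel_measurable borel \<Longrightarrow> f \<in> borel_measurable (period_measure T)"
  by (intro measurable_restrict_space1) simp

lemma integral_harmonic:
  assumes T: "T > 0"
  shows "(LINT x|period_measure T. harmonic T k x) = (if k = 0 then of_real T else 0)"
proof (cases "k = 0")
  case True
  have "measure lborel {0..<T} = T" using T by (simp add: measure_def)
  then show ?thesis using True
    by (simp add: harmonic_def measure_restrict_space space_restrict_space scaleR_conv_of_real)
next
  case False
  define c :: complex where "c = 2 * of_real pi * \<i> * of_int k / of_real T"
  have c: "c \<noteq> 0" using False T by (simp add: c_def)
  have h: "harmonic T k x = exp (c * of_real x)" for x
    by (simp add: harmonic_def c_def cis_conv_exp algebra_simps)
  have "(LINT x|period_measure T. harmonic T k x) = (LINT x|lborel. indicator {0..<T} x *\<^sub>R harmonic T k x)"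
    by (subst integral_restrict_space) (auto simp: set_lebesgue_integral_def)
  also have "\<dots> = (LINT x|lborel. indicator {0..T} x *\<^sub>R harmonic T k x)"
  proof (rule integral_cong_AE)
    show "AE x in lborel. indicator {0..<T} x *\<^sub>R harmonic T k x = indicator {0..T} x *\<^sub>R harmonic T k x"
      using AE_lborel_singleton[of T] by eventually_elim (auto simp: indicator_def)
  qed auto
  also have "\<dots> = exp (c * of_real T) / c - exp (c * of_real 0) / c"
  proof (rule integral_FTC_Icc)
    show "continuous_on {0..T} (harmonic T k)" by (rule continuous_on_harmonic)
    show "((\<lambda>x. exp (c * of_real x) / c) has_vector_derivative harmonic T k x) (at x within {0..T})" for x
      unfolding h using c by (auto intro!: derivative_eq_intros has_vector_derivative_real_field)
  qed (use T in simp)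
  also have "exp (c * of_real T) = 1"
  proof -
    have "c * of_real T = of_int (2 * k) * (of_real pi * \<i>)" using T by (simp add: c_def)
    then show ?thesis using exp_eq_1[of "c * of_real T"] by (auto simp: mult.commute)
  qed
  finally show ?thesis using False by simp
qed

section \<open>Density of trigonometric polynomials\<close>

definition trig_poly :: "real \<Rightarrow> (real \<Rightarrow> complex) \<Rightarrow> bool" where
  "trig_poly T f \<longleftrightarrow> (\<exists>S b. finite S \<and> f = (\<lambda>x. \<Sum>k\<in>S. b k * harmonic T k x))"

lemma trig_poly_harmonic: "trig_poly T (\<lambda>x. c * harmonic T k x)"
  unfolding trig_poly_def by (intro exI[of _ "{k}"] exI[of _ "\<lambda>_. c"]) auto

lemma trig_poly_const: "trig_poly T (\<lambda>x. c)"
  using trig_poly_harmonic[of T c 0] by (simp add: harmonic_def)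

lemma trig_poly_add:
  assumes "trig_poly T f" "trig_poly T g"
  shows "trig_poly T (\<lambda>x. f x + g x)"
proof -
  from assms obtain S b S' b' where S: "finite S" "f = (\<lambda>x. \<Sum>k\<in>S. b k * harmonic T k x)"
    and S': "finite S'" "g = (\<lambda>x. \<Sum>k\<in>S'. b' k * harmonic T k x)"
    unfolding trig_poly_def by blast
  define d where "d k = (if k \<in> S then b k else 0) + (if k \<in> S' then b' k else 0)" for k
  have f: "(\<Sum>k\<in>S. b k * harmonic T k x) = (\<Sum>k\<in>S\<union>S'. (if k \<in> S then b k else 0) * harmonic T k x)" for x
    using S S' by (intro sum.mono_neutral_cong_left) auto
  have g: "(\<Sum>k\<in>S'. b' k * harmonic T k x) = (\<Sum>k\<in>S\<union>S'. (if k \<in> S' then b' k else 0) * harmonic T k x)" for x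
    using S S' by (intro sum.mono_neutral_cong_left) auto
  have "f x + g x = (\<Sum>k\<in>S\<union>S'. d k * harmonic T k x)" for x
    unfolding S S' f g d_def by (simp only: sum.distrib distrib_right)
  then show ?thesis unfolding trig_poly_def using S S' by (intro exI[of _ "S \<union> S'"] exI[of _ d]) auto
qed

lemma trig_poly_sum: "finite I \<Longrightarrow> (\<And>i. i \<in> I \<Longrightarrow> trig_poly T (f i)) \<Longrightarrow> trig_poly T (\<lambda>x. \<Sum>i\<in>I. f i x)"
  by (induction I rule: finite_induct) (auto intro: trig_poly_add trig_poly_const)

lemma trig_poly_mult:
  assumes "trig_poly T f" "trig_poly T g"
  shows "trig_poly T (\<lambda>x. f x * g x)"
proof -
  from assms obtain S b S' b' where S: "finite S" "f = (\<lambda>x. \<Sum>k\<in>S. b k * harmonic T k x)"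
    and S': "finite S'" "g = (\<lambda>x. \<Sum>k\<in>S'. b' k * harmonic T k x)"
    unfolding trig_poly_def by blast
  have "f x * g x = (\<Sum>k\<in>S. \<Sum>l\<in>S'. (b k * b' l) * harmonic T (k + l) x)" for x
    unfolding S S' sum_product by (simp add: harmonic_mult[symmetric] mult_ac)
  then have "(\<lambda>x. f x * g x) = (\<lambda>x. \<Sum>k\<in>S. \<Sum>l\<in>S'. (b k * b' l) * harmonic T (k + l) x)"
    by blast
  then show ?thesis using S S' by (auto intro!: trig_poly_sum trig_poly_harmonic)
qed

lemma trig_poly_of_real_polynomial:
  fixes r :: "complex \<Rightarrow> real"
  assumes "real_polynomial_function r"
  shows "trig_poly T (\<lambda>x. of_real (r (harmonic T 1 x)))"
  using assms
proof (induction r rule: real_polynomial_function.induct)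
  case (linear f)
  have f: "f z = f 1 * Re z + f \<i> * Im z" for z
  proof -
    interpret bounded_linear f by fact
    have "f z = f (Re z *\<^sub>R 1 + Im z *\<^sub>R \<i>)"
      by (rule arg_cong[of _ _ f]) (simp add: complex_eq_iff)
    also have "\<dots> = f 1 * Re z + f \<i> * Im z" by (simp only: add scaleR) simp
    finally show ?thesis .
  qed
  have "of_real (f (harmonic T 1 x)) = ((of_real (f 1) - \<i> * of_real (f \<i>)) / 2) * harmonic T 1 x
      + ((of_real (f 1) + \<i> * of_real (f \<i>)) / 2) * harmonic T (-1) x" for x
    unfolding f[of "harmonic T 1 x"]
    by (simp add: complex_eq_iff diff_divide_distrib add_divide_distrib flip: cnj_harmonic)
  then show ?case by (simp only:) (intro trig_poly_add trig_poly_harmonic)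
next
  case (const c)
  show ?case by (rule trig_poly_const)
next
  case (add f g)
  then show ?case by (simp add: trig_poly_add)
next
  case (mult f g)
  then show ?case by (simp add: trig_poly_mult)
qed

text \<open>A continuous function with equal values at the end points of the period descends to a continuous
  function on the unit circle, where real polynomials in the coordinates are dense and restrict to
  trigonometric polynomials.  Continuity of the descended function is the fact that a loop is
  homotopic to itself, read on the circle.\<close>

lemma trig_poly_uniform_approx:
  fixes f :: "real \<Rightarrow> complex"
  assumes T: "T > 0" and f: "continuous_on {0..T} f" "f 0 = f T" and e: "e > 0"
  obtains p where "trig_poly T p" "\<And>x. 0 \<le> x \<Longrightarrow> x < T \<Longrightarrow> cmod (f x - p x) < e"
proof -
  define l where "l t = f (T * t)" for t
  have "continuous_on {0..1} l" unfolding l_def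
    by (rule continuous_on_compose2[OF f(1)]) (use T in \<open>auto intro!: continuous_intros simp: mult_left_le\<close>)
  then have "homotopic_loops UNIV l l"
    by (simp add: homotopic_loops_refl path_def pathfinish_def pathstart_def l_def f(2))
  from homotopic_loops_imp_homotopic_circlemaps[OF this]
  have "continuous_on (sphere 0 1) (l \<circ> (\<lambda>z. Arg2pi z / (2 * pi)))"
    using homotopic_with_imp_continuous by blast
  from Stone_Weierstrass_polynomial_function[OF compact_sphere this e]
  obtain P :: "complex \<Rightarrow> complex" where P: "polynomial_function P"
    and Pe: "\<And>z. z \<in> sphere 0 1 \<Longrightarrow> cmod (l (Arg2pi z / (2 * pi)) - P z) < e"
    by (auto simp: o_def)
  define p where "p x = P (harmonic T 1 x)" for x
  have re: "real_polynomial_function (\<lambda>z. Re (P z))" "real_polynomial_function (\<lambda>z. Im (P z))"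
    using P bounded_linear_Re bounded_linear_Im unfolding polynomial_function_def o_def by blast+
  have "p x = of_real (Re (P (harmonic T 1 x))) + \<i> * of_real (Im (P (harmonic T 1 x)))" for x
    by (simp add: p_def complex_eq_iff)
  then have "p = (\<lambda>x. of_real (Re (P (harmonic T 1 x))) + \<i> * of_real (Im (P (harmonic T 1 x))))"
    by blast
  then have "trig_poly T p"
    by (simp only:) (intro trig_poly_add trig_poly_mult trig_poly_const
        trig_poly_of_real_polynomial[OF re(1)] trig_poly_of_real_polynomial[OF re(2)])
  moreover have "cmod (f x - p x) < e" if x: "0 \<le> x" "x < T" for x
  proof -
    have "Arg2pi (harmonic T 1 x) = 2 * pi * x / T"
      by (rule Arg2pi_unique[of 1]) (use x T in \<open>auto simp: harmonic_def cis_conv_exp field_simps\<close>)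
    then have "l (Arg2pi (harmonic T 1 x) / (2 * pi)) = f x" using T by (simp add: l_def)
    then show ?thesis using Pe[of "harmonic T 1 x"] by (simp add: p_def)
  qed
  ultimately show ?thesis using that by blast
qed

definition l2_approximable :: "real \<Rightarrow> (real \<Rightarrow> complex) \<Rightarrow> bool" where
  "l2_approximable T F \<longleftrightarrow>
    (\<forall>\<epsilon>>0. \<exists>p. trig_poly T p \<and> (\<integral>\<^sup>+x. (ennreal (cmod (F x - p x)))\<^sup>2 \<partial>period_measure T) \<le> ennreal \<epsilon>)"

lemma borel_measurable_trig_poly: "trig_poly T p \<Longrightarrow> p \<in> borel_measurable borel"
  by (auto simp: trig_poly_def)

lemma ennreal_norm_add_sq: "(ennreal (cmod (u + v)))\<^sup>2 \<le> 2 * (ennreal (cmod u))\<^sup>2 + 2 * (ennreal (cmod v))\<^sup>2"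
proof -
  have "(cmod (u + v))\<^sup>2 \<le> (cmod u + cmod v)\<^sup>2" by (intro power_mono norm_triangle_ineq) simp
  also have "\<dots> \<le> 2 * (cmod u)\<^sup>2 + 2 * (cmod v)\<^sup>2"
    using zero_le_power2[of "cmod u - cmod v"] by (simp add: power2_eq_square algebra_simps)
  finally have "ennreal ((cmod (u + v))\<^sup>2) \<le> ennreal (2 * (cmod u)\<^sup>2 + 2 * (cmod v)\<^sup>2)"
    by (rule ennreal_leI)
  then show ?thesis by (simp add: ennreal_plus ennreal_mult ennreal_power)
qed

lemma l2_approximable_closure:
  assumes F: "F \<in> borel_measurable (period_measure T)"
    and approx: "\<And>\<epsilon>. \<epsilon> > 0 \<Longrightarrow> \<exists>G. G \<in> borel_measurable (period_measure T) \<and> l2_approximable T G \<and>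
      (\<integral>\<^sup>+x. (ennreal (cmod (F x - G x)))\<^sup>2 \<partial>period_measure T) \<le> ennreal \<epsilon>"
  shows "l2_approximable T F"
  unfolding l2_approximable_def
proof (intro allI impI)
  fix \<epsilon> :: real assume e: "\<epsilon> > 0"
  obtain G where G: "G \<in> borel_measurable (period_measure T)" "l2_approximable T G"
      "(\<integral>\<^sup>+x. (ennreal (cmod (F x - G x)))\<^sup>2 \<partial>period_measure T) \<le> ennreal (\<epsilon> / 4)"
    using approx[of "\<epsilon> / 4"] e by auto
  obtain p where p: "trig_poly T p"
      "(\<integral>\<^sup>+x. (ennreal (cmod (G x - p x)))\<^sup>2 \<partial>period_measure T) \<le> ennreal (\<epsilon> / 4)"
    using G(2) e unfolding l2_approximable_def by (metis divide_pos_pos zero_less_numeral)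
  note [measurable] = F G(1) borel_measurable_period[OF borel_measurable_trig_poly[OF p(1)]]
  have "(\<integral>\<^sup>+x. (ennreal (cmod (F x - p x)))\<^sup>2 \<partial>period_measure T)
    \<le> (\<integral>\<^sup>+x. 2 * (ennreal (cmod (F x - G x)))\<^sup>2 + 2 * (ennreal (cmod (G x - p x)))\<^sup>2 \<partial>period_measure T)"
  proof (intro nn_integral_mono)
    fix x
    show "(ennreal (cmod (F x - p x)))\<^sup>2
        \<le> 2 * (ennreal (cmod (F x - G x)))\<^sup>2 + 2 * (ennreal (cmod (G x - p x)))\<^sup>2"
      using ennreal_norm_add_sq[of "F x - G x" "G x - p x"] by simp
  qed
  also have "\<dots> = 2 * (\<integral>\<^sup>+x. (ennreal (cmod (F x - G x)))\<^sup>2 \<partial>period_measure T)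
      + 2 * (\<integral>\<^sup>+x. (ennreal (cmod (G x - p x)))\<^sup>2 \<partial>period_measure T)"
    by (simp add: nn_integral_add nn_integral_cmult)
  also have "\<dots> \<le> 2 * ennreal (\<epsilon> / 4) + 2 * ennreal (\<epsilon> / 4)"
    using G(3) p(2) by (intro add_mono mult_left_mono) auto
  also have "\<dots> = ennreal (2 * (\<epsilon> / 4) + 2 * (\<epsilon> / 4))"
    using e by (simp only: ennreal_plus ennreal_mult ennreal_numeral)
  also have "\<dots> = ennreal \<epsilon>" by simp
  finally show "\<exists>p. trig_poly T p \<and> (\<integral>\<^sup>+x. (ennreal (cmod (F x - p x)))\<^sup>2 \<partial>period_measure T) \<le> ennreal \<epsilon>"
    using p(1) by blast
qed

lemma l2_approximable_limit:
  fixes G :: "nat \<Rightarrow> real \<Rightarrow> complex"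
  assumes F: "F \<in> borel_measurable (period_measure T)"
    and G: "\<And>n. G n \<in> borel_measurable (period_measure T)" "\<And>n. l2_approximable T (G n)"
    and lim: "AE x in period_measure T. (\<lambda>n. G n x) \<longlonglongrightarrow> F x"
    and dom: "\<And>n. AE x in period_measure T. (ennreal (cmod (F x - G n x)))\<^sup>2 \<le> w x"
    and w: "w \<in> borel_measurable (period_measure T)" "(\<integral>\<^sup>+x. w x \<partial>period_measure T) < \<infinity>"
  shows "l2_approximable T F"
proof (rule l2_approximable_closure[OF F])
  fix \<epsilon> :: real assume e: "\<epsilon> > 0"
  note [measurable] = F G(1) w(1)
  have "(\<lambda>n. \<integral>\<^sup>+x. (ennreal (cmod (F x - G n x)))\<^sup>2 \<partial>period_measure T)
      \<longlonglongrightarrow> (\<integral>\<^sup>+x. 0 \<partial>period_measure T)"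
  proof (rule nn_integral_dominated_convergence[OF _ _ w(1) dom w(2)])
    show "AE x in period_measure T. (\<lambda>n. (ennreal (cmod (F x - G n x)))\<^sup>2) \<longlonglongrightarrow> 0"
      using lim
    proof eventually_elim
      case (elim x)
      have "(\<lambda>n. (cmod (F x - G n x))\<^sup>2) \<longlonglongrightarrow> (cmod (F x - F x))\<^sup>2"
        by (intro tendsto_intros elim)
      then have "(\<lambda>n. ennreal ((cmod (F x - G n x))\<^sup>2)) \<longlonglongrightarrow> ennreal ((cmod (F x - F x))\<^sup>2)"
        by (rule tendsto_ennrealI)
      then show ?case by (simp add: ennreal_power)
    qed
  qed auto
  then have "(\<lambda>n. \<integral>\<^sup>+x. (ennreal (cmod (F x - G n x)))\<^sup>2 \<partial>period_measure T) \<longlonglongrightarrow> 0" by simp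
  then have "\<forall>\<^sub>F n in sequentially. (\<integral>\<^sup>+x. (ennreal (cmod (F x - G n x)))\<^sup>2 \<partial>period_measure T) < ennreal \<epsilon>"
    by (rule order_tendstoD) (use e in simp)
  then obtain n where "(\<integral>\<^sup>+x. (ennreal (cmod (F x - G n x)))\<^sup>2 \<partial>period_measure T) < ennreal \<epsilon>"
    by (meson eventually_sequentially order_refl)
  then show "\<exists>G. G \<in> borel_measurable (period_measure T) \<and> l2_approximable T G \<and>
      (\<integral>\<^sup>+x. (ennreal (cmod (F x - G x)))\<^sup>2 \<partial>period_measure T) \<le> ennreal \<epsilon>"
    using G by (intro exI[of _ "G n"]) (auto intro: less_imp_le)
qed

lemma l2_approximable_continuous:
  assumes T: "T > 0" and f: "continuous_on {0..T} f" "f 0 = f T"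
  shows "l2_approximable T f"
  unfolding l2_approximable_def
proof (intro allI impI)
  fix \<epsilon> :: real assume e: "\<epsilon> > 0"
  obtain p where p: "trig_poly T p" "\<And>x. 0 \<le> x \<Longrightarrow> x < T \<Longrightarrow> cmod (f x - p x) < sqrt (\<epsilon> / T)"
    using trig_poly_uniform_approx[OF T f, of "sqrt (\<epsilon> / T)"] e T by auto
  have "(\<integral>\<^sup>+x. (ennreal (cmod (f x - p x)))\<^sup>2 \<partial>period_measure T) \<le> (\<integral>\<^sup>+x. ennreal (\<epsilon> / T) \<partial>period_measure T)"
  proof (rule nn_integral_mono)
    fix x assume "x \<in> space (period_measure T)"
    then have "cmod (f x - p x) < sqrt (\<epsilon> / T)" using p(2) by (auto simp: space_restrict_space)
    then have "(cmod (f x - p x))\<^sup>2 \<le> (sqrt (\<epsilon> / T))\<^sup>2" by (intro power_mono) auto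
    also have "\<dots> = \<epsilon> / T" using e T by simp
    finally show "(ennreal (cmod (f x - p x)))\<^sup>2 \<le> ennreal (\<epsilon> / T)"
      by (simp add: ennreal_power ennreal_leI)
  qed
  also have "\<dots> = ennreal \<epsilon>"
    using T e by (simp add: space_restrict_space emeasure_restrict_space flip: ennreal_mult)
  finally show "\<exists>p. trig_poly T p \<and> (\<integral>\<^sup>+x. (ennreal (cmod (f x - p x)))\<^sup>2 \<partial>period_measure T) \<le> ennreal \<epsilon>"
    using p(1) by blast
qed

text \<open>A measurable function is almost everywhere a limit of continuous functions \<open>f n\<close>.  Projecting their
  values onto the disc of radius \<open>K\<close> makes the convergence dominated, and a cutoff near the end points
  of the period makes them periodic; neither changes the limit.\<close>

lemma l2_approximable_bounded:
  assumes T: "T > 0" and F: "F \<in> borel_measurable (period_measure T)"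
    and K: "K > 0" "\<And>x. x \<in> {0..<T} \<Longrightarrow> cmod (F x) \<le> K"
  shows "l2_approximable T F"
proof -
  define F' where "F' x = indicator {0..<T} x *\<^sub>R F x" for x
  have "F' \<in> borel_measurable borel"
    using F by (subst (asm) borel_measurable_restrict_space_iff) (auto simp: F'_def[abs_def])
  then have "F' measurable_on UNIV"
    by (subst measurable_on_iff_borel_measurable)
       (auto intro!: measurable_restrict_space1 measurable_completion)
  then obtain N f where N: "negligible N" and f: "\<And>n. continuous_on UNIV (f n)"
    and lim: "\<And>x. x \<notin> N \<Longrightarrow> (\<lambda>n. f n x) \<longlonglongrightarrow> F' x"
    unfolding measurable_on_def by auto
  define \<eta> where "\<eta> n x = max 0 (min 1 (min (of_nat n * x) (of_nat n * (T - x))))" for n :: nat and x :: real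
  define G where "G n x = \<eta> n x *\<^sub>R closest_point (cball 0 K) (f n x)" for n x
  have cl: "continuous_on A (closest_point (cball (0::complex) K))" for A
    using K by (intro continuous_on_closest_point) auto
  have contG: "continuous_on A (G n)" for A n
    unfolding G_def \<eta>_def
    by (intro continuous_intros continuous_on_compose2[OF cl[of UNIV]] continuous_on_subset[OF f]) auto
  have G_le: "cmod (G n x) \<le> K" for n x
  proof -
    have "closest_point (cball 0 K) (f n x) \<in> cball 0 K" using K by (intro closest_point_in_set) auto
    then have "cmod (closest_point (cball 0 K) (f n x)) \<le> K" by simp
    moreover have "0 \<le> \<eta> n x" "\<eta> n x \<le> 1" by (auto simp: \<eta>_def)
    ultimately show ?thesis
      using mult_left_le_one_le[of "cmod (closest_point (cball 0 K) (f n x))" "\<eta> n x"] by (simp add: G_def)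
  qed
  have G_lim: "(\<lambda>n. G n x) \<longlonglongrightarrow> F x" if x: "x \<notin> N" "0 < x" "x < T" for x
  proof -
    have F'x: "F' x = F x" using x by (simp add: F'_def)
    obtain n0 :: nat where n0: "1 / x + 1 / (T - x) < of_nat n0" using reals_Archimedean2 by blast
    have "\<forall>\<^sub>F n in sequentially. \<eta> n x = 1"
      using eventually_ge_at_top[of n0]
    proof eventually_elim
      case (elim n)
      have "1 / x > 0" "1 / (T - x) > 0" using x by auto
      then have "1 / x \<le> of_nat n" "1 / (T - x) \<le> of_nat n" using n0 elim by linarith+
      then have "1 \<le> of_nat n * x" "1 \<le> of_nat n * (T - x)" using x by (auto simp: field_simps)
      then show ?case by (simp add: \<eta>_def)
    qed
    then have chi: "(\<lambda>n. \<eta> n x) \<longlonglongrightarrow> 1" by (rule tendsto_eventually)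
    have "(\<lambda>n. closest_point (cball 0 K) (f n x)) \<longlonglongrightarrow> closest_point (cball 0 K) (F' x)"
      by (rule continuous_on_tendsto_compose[OF cl[of UNIV]]) (use lim[OF x(1)] in auto)
    also have "closest_point (cball 0 K) (F' x) = F x"
      using K(2)[of x] x by (simp add: F'x closest_point_self)
    finally show ?thesis using tendsto_scaleR[OF chi] unfolding G_def by fastforce
  qed
  have "AE x in lebesgue. x \<notin> N" using N by (intro AE_not_in) (simp add: negligible_iff_null_sets)
  then have aeN: "AE x in lborel. x \<notin> N" by (simp add: AE_completion_iff)
  show ?thesis
  proof (rule l2_approximable_limit[OF F, where G = G and w = "\<lambda>_. ennreal ((2 * K)\<^sup>2)"])
    show "G n \<in> borel_measurable (period_measure T)" for n
      by (intro borel_measurable_period borel_measurable_continuous_onI contG)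
    show "l2_approximable T (G n)" for n
      using T by (intro l2_approximable_continuous contG) (auto simp: G_def \<eta>_def)
    show "AE x in period_measure T. (\<lambda>n. G n x) \<longlonglongrightarrow> F x"
    proof (subst AE_restrict_space_iff)
      show "AE x in lborel. x \<in> {0..<T} \<longrightarrow> (\<lambda>n. G n x) \<longlonglongrightarrow> F x"
        using aeN AE_lborel_singleton[of 0] by eventually_elim (auto intro!: G_lim)
    qed simp
    show "AE x in period_measure T. (ennreal (cmod (F x - G n x)))\<^sup>2 \<le> ennreal ((2 * K)\<^sup>2)" for n
    proof (rule AE_I2)
      fix x assume "x \<in> space (period_measure T)"
      then have "cmod (F x - G n x) \<le> 2 * K"
        using K(2)[of x] G_le[of n x] norm_triangle_ineq4[of "F x" "G n x"] by (auto simp: space_restrict_space)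
      then have "(cmod (F x - G n x))\<^sup>2 \<le> (2 * K)\<^sup>2" by (intro power_mono) auto
      then show "(ennreal (cmod (F x - G n x)))\<^sup>2 \<le> ennreal ((2 * K)\<^sup>2)" 
        by (simp add: ennreal_power ennreal_leI)
    qed
    show "(\<integral>\<^sup>+x. ennreal ((2 * K)\<^sup>2) \<partial>period_measure T) < \<infinity>"
      using T by (simp add: space_restrict_space emeasure_restrict_space ennreal_mult_less_top)
  qed simp
qed

lemma l2_approximable_L2:
  assumes T: "T > 0" and F: "F \<in> borel_measurable (period_measure T)"
    and fin: "(\<integral>\<^sup>+x. (ennreal (cmod (F x)))\<^sup>2 \<partial>period_measure T) < \<infinity>"
  shows "l2_approximable T F"
proof (rule l2_approximable_limit[OF F,
    where G = "\<lambda>n x. if cmod (F x) \<le> of_nat n then F x else 0" and w = "\<lambda>x. (ennreal (cmod (F x)))\<^sup>2"])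
  note [measurable] = F
  show G: "(\<lambda>x. if cmod (F x) \<le> real n then F x else 0) \<in> borel_measurable (period_measure T)" for n
    by measurable
  show "l2_approximable T (\<lambda>x. if cmod (F x) \<le> real n then F x else 0)" for n
    by (rule l2_approximable_bounded[OF T G, of "real n + 1"]) auto
  show "AE x in period_measure T. (\<lambda>n. if cmod (F x) \<le> real n then F x else 0) \<longlonglongrightarrow> F x"
  proof (rule AE_I2)
    fix x
    obtain n0 :: nat where "cmod (F x) < of_nat n0" using reals_Archimedean2 by blast
    then show "(\<lambda>n. if cmod (F x) \<le> real n then F x else 0) \<longlonglongrightarrow> F x"
      by (intro tendsto_eventually eventually_sequentiallyI[of n0]) auto
  qed
  show "AE x in period_measure T. (ennreal (cmod (F x - (if cmod (F x) \<le> real n then F x else 0))))\<^sup>2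
      \<le> (ennreal (cmod (F x)))\<^sup>2" for n
    by (rule AE_I2) auto
  show "(\<lambda>x. (ennreal (cmod (F x)))\<^sup>2) \<in> borel_measurable (period_measure T)" by measurable
qed (rule fin)

section \<open>Parseval's identity\<close>

lemma L2_period_integrable:
  assumes F: "F \<in> borel_measurable (period_measure T)"
    and fin: "(\<integral>\<^sup>+x. (ennreal (cmod (F x)))\<^sup>2 \<partial>period_measure T) < \<infinity>"
  shows "integrable (period_measure T) (\<lambda>x. (cmod (F x))\<^sup>2)" "integrable (period_measure T) F"
proof -
  note [measurable] = F
  interpret finite_measure "period_measure T" by (rule finite_measure_period)
  show sq: "integrable (period_measure T) (\<lambda>x. (cmod (F x))\<^sup>2)"
    by (rule integrableI_bounded) (use fin in \<open>auto simp: ennreal_power\<close>)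
  show "integrable (period_measure T) F"
  proof (rule Bochner_Integration.integrable_bound)
    show "integrable (period_measure T) (\<lambda>x. 1 + (cmod (F x))\<^sup>2)" using sq by simp
    have "t \<le> 1 + t\<^sup>2" if "t \<ge> 0" for t :: real
      using zero_le_power2[of "t - 1"] that by (simp add: power2_eq_square algebra_simps)
    then show "AE x in period_measure T. cmod (F x) \<le> norm (1 + (cmod (F x))\<^sup>2)"
      by (intro AE_I2) simp
  qed measurable
qed

text \<open>Pythagoras for the orthogonal system of harmonics.  The case \<open>b k = a k / T\<close> is Bessel's inequality;
  for other \<open>b\<close> the last summand measures how much worse the approximation is.\<close>

lemma trig_approx_error:
  fixes F :: "real \<Rightarrow> complex"
  assumes T: "T > 0" and F: "F \<in> borel_measurable (period_measure T)"
    and fin: "(\<integral>\<^sup>+x. (ennreal (cmod (F x)))\<^sup>2 \<partial>period_measure T) < \<infinity>"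
    and S: "finite S"
  defines "a k \<equiv> (LINT x|period_measure T. F x * cnj (harmonic T k x))"
  shows "(LINT x|period_measure T. (cmod (F x - (\<Sum>k\<in>S. b k * harmonic T k x)))\<^sup>2)
    = (LINT x|period_measure T. (cmod (F x))\<^sup>2) - (\<Sum>k\<in>S. (cmod (a k))\<^sup>2) / T
      + T * (\<Sum>k\<in>S. (cmod (b k - a k / of_real T))\<^sup>2)"
proof -
  let ?M = "period_measure T"
  interpret finite_measure ?M by (rule finite_measure_period)
  have [measurable]: "harmonic T k \<in> borel_measurable ?M" for k
    by (intro borel_measurable_period borel_measurable_harmonic)
  have int_h: "integrable ?M (\<lambda>x. h x * cnj (harmonic T k x))" if "integrable ?M h"
    for h :: "real \<Rightarrow> complex" and k
  proof (rule Bochner_Integration.integrable_bound[OF that])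
    have [measurable]: "h \<in> borel_measurable ?M" using that by simp
    show "(\<lambda>x. h x * cnj (harmonic T k x)) \<in> borel_measurable ?M"
      unfolding cnj_harmonic by measurable
  qed (auto simp: norm_mult)
  have int_harm: "integrable ?M (harmonic T k)" for k
    by (rule integrable_const_bound[of _ 1]) auto
  have orth: "(LINT x|?M. harmonic T k x * cnj (harmonic T l x)) = (if k = l then of_real T else 0)" for k l
    by (simp add: cnj_harmonic harmonic_mult integral_harmonic[OF T])
  have "integrable ?M (\<lambda>x. F x - (\<Sum>k\<in>S. b k * harmonic T k x))
     \<and> integrable ?M (\<lambda>x. (cmod (F x - (\<Sum>k\<in>S. b k * harmonic T k x)))\<^sup>2)
     \<and> (\<forall>l. l \<notin> S \<longrightarrow> (LINT x|?M. (F x - (\<Sum>k\<in>S. b k * harmonic T k x)) * cnj (harmonic T l x)) = a l)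
     \<and> (LINT x|?M. (cmod (F x - (\<Sum>k\<in>S. b k * harmonic T k x)))\<^sup>2)
    = (LINT x|?M. (cmod (F x))\<^sup>2) - (\<Sum>k\<in>S. (cmod (a k))\<^sup>2) / T
      + T * (\<Sum>k\<in>S. (cmod (b k - a k / of_real T))\<^sup>2)"
    using S
  proof (induction S rule: finite_induct)
    case empty
    show ?case using L2_period_integrable[OF F fin] by (auto simp: a_def)
  next
    case (insert m S)
    define G where "G x = F x - (\<Sum>k\<in>S. b k * harmonic T k x)" for x
    have G: "integrable ?M G" "integrable ?M (\<lambda>x. (cmod (G x))\<^sup>2)"
        and Ga: "\<And>l. l \<notin> S \<Longrightarrow> (LINT x|?M. G x * cnj (harmonic T l x)) = a l"
        and GI: "(LINT x|?M. (cmod (G x))\<^sup>2) = (LINT x|?M. (cmod (F x))\<^sup>2)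
          - (\<Sum>k\<in>S. (cmod (a k))\<^sup>2) / T + T * (\<Sum>k\<in>S. (cmod (b k - a k / of_real T))\<^sup>2)"
      using insert.IH by (auto simp: G_def[abs_def])
    have eq: "F x - (\<Sum>k\<in>insert m S. b k * harmonic T k x) = G x - b m * harmonic T m x" for x
      using insert.hyps by (simp add: G_def)
    define w where "w x = cnj (b m) * (G x * cnj (harmonic T m x))" for x
    have intw: "integrable ?M w"
      unfolding w_def[abs_def] using int_h[OF G(1), of m] by (rule integrable_mult_right)
    have "(LINT x|?M. w x) = cnj (b m) * a m"
      unfolding w_def using Ga[OF insert.hyps(2)] by simp
    then have Rew: "(LINT x|?M. Re (w x)) = Re (cnj (b m) * a m)"
      using integral_Re[OF intw] by simp
    have sq: "(cmod (G x - b m * harmonic T m x))\<^sup>2 = (cmod (G x))\<^sup>2 - 2 * Re (w x) + (cmod (b m))\<^sup>2" for x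
    proof -
      have "(cmod (u - v))\<^sup>2 = (cmod u)\<^sup>2 - 2 * Re (cnj v * u) + (cmod v)\<^sup>2" for u v
        unfolding cmod_power2 by (simp add: power2_eq_square algebra_simps)
      from this[of "G x" "b m * harmonic T m x"] show ?thesis by (simp add: w_def norm_mult mult_ac)
    qed
    have int1: "integrable ?M (\<lambda>x. Re (w x))" using intw by (rule integrable_Re)
    have "measure ?M {0..<T} = T"
      using T by (simp add: measure_restrict_space)
    then have I: "(LINT x|?M. (cmod (G x - b m * harmonic T m x))\<^sup>2)
        = (LINT x|?M. (cmod (G x))\<^sup>2) - 2 * Re (cnj (b m) * a m) + T * (cmod (b m))\<^sup>2"
      unfolding sq Rew[symmetric] using G(2) int1 by (simp add: space_restrict_space)
    have J: "T * (cmod (b m - a m / of_real T))\<^sup>2 = T * (cmod (b m))\<^sup>2 - 2 * Re (cnj (b m) * a m) + (cmod (a m))\<^sup>2 / T"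
      unfolding cmod_power2 using T by (simp add: power2_eq_square field_simps)
    have "integrable ?M (\<lambda>x. G x - b m * harmonic T m x)"
      using G(1) int_harm[of m] by simp
    moreover have "integrable ?M (\<lambda>x. (cmod (G x - b m * harmonic T m x))\<^sup>2)"
      unfolding sq using G(2) int1 by simp
    moreover have "(LINT x|?M. (G x - b m * harmonic T m x) * cnj (harmonic T l x)) = a l" if l: "l \<notin> insert m S" for l
    proof -
      have "(LINT x|?M. (G x - b m * harmonic T m x) * cnj (harmonic T l x))
         = (LINT x|?M. G x * cnj (harmonic T l x) - b m * (harmonic T m x * cnj (harmonic T l x)))"
        by (simp add: algebra_simps)
      also have "\<dots> = a l" using l int_h[OF G(1), of l] int_h[OF int_harm[of m], of l] Ga[of l]
        by (auto simp: orth)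
      finally show ?thesis .
    qed
    moreover have "(LINT x|?M. (cmod (G x - b m * harmonic T m x))\<^sup>2)
      = (LINT x|?M. (cmod (F x))\<^sup>2) - (\<Sum>k\<in>insert m S. (cmod (a k))\<^sup>2) / T
      + T * (\<Sum>k\<in>insert m S. (cmod (b k - a k / of_real T))\<^sup>2)"
      unfolding I GI using insert.hyps J by (simp add: distrib_left add_divide_distrib)
    ultimately show ?case unfolding eq by blast
  qed
  then show ?thesis by blast
qed

text \<open>One inequality is Bessel's; for the other, the error of any sufficiently good trigonometric
  approximation bounds the part of the norm that the coefficients miss.\<close>

lemma parseval:
  fixes F :: "real \<Rightarrow> complex"
  assumes T: "T > 0" and F: "F \<in> borel_measurable (period_measure T)"
    and fin: "(\<integral>\<^sup>+x. (ennreal (cmod (F x)))\<^sup>2 \<partial>period_measure T) < \<infinity>"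
  shows "(\<integral>\<^sup>+k. (ennreal (cmod (LINT x|period_measure T. F x * cnj (harmonic T k x))))\<^sup>2 \<partial>count_space UNIV)
    = ennreal T * (\<integral>\<^sup>+x. (ennreal (cmod (F x)))\<^sup>2 \<partial>period_measure T)"
proof -
  let ?M = "period_measure T"
  define a where "a k = (LINT x|?M. F x * cnj (harmonic T k x))" for k
  define N where "N = (LINT x|?M. (cmod (F x))\<^sup>2)"
  note sq = L2_period_integrable(1)[OF F fin]
  have N: "(\<integral>\<^sup>+x. (ennreal (cmod (F x)))\<^sup>2 \<partial>?M) = ennreal N"
    using nn_integral_eq_integral[OF sq] by (simp add: N_def ennreal_power)
  have N0: "N \<ge> 0" by (simp add: N_def)
  note err = trig_approx_error[OF T F fin, folded a_def N_def]
  have bessel: "(\<Sum>k\<in>S. (cmod (a k))\<^sup>2) \<le> T * N" if S: "finite S" for S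
  proof -
    have "0 \<le> (LINT x|?M. (cmod (F x - (\<Sum>k\<in>S. (a k / of_real T) * harmonic T k x)))\<^sup>2)" by simp
    also have "\<dots> = N - (\<Sum>k\<in>S. (cmod (a k))\<^sup>2) / T"
      unfolding err[OF S] by simp
    finally show ?thesis using T by (simp add: field_simps)
  qed
  have "(\<integral>\<^sup>+k. (ennreal (cmod (a k)))\<^sup>2 \<partial>count_space UNIV)
      = (\<integral>\<^sup>+n. (ennreal (cmod (a (int_decode n))))\<^sup>2 \<partial>count_space UNIV)"
    by (rule nn_integral_bij_count_space[symmetric]) (rule bij_int_decode)
  also have "\<dots> = (\<Sum>n. ennreal ((cmod (a (int_decode n)))\<^sup>2))"
    by (simp add: nn_integral_count_space_nat ennreal_power)
  also have "\<dots> \<le> ennreal (T * N)"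
  proof (rule suminf_le_const)
    fix n
    have inj: "inj_on int_decode {..<n}" using bij_int_decode by (meson bij_is_inj inj_on_subset subset_UNIV)
    have "(\<Sum>i<n. ennreal ((cmod (a (int_decode i)))\<^sup>2)) = ennreal (\<Sum>i<n. (cmod (a (int_decode i)))\<^sup>2)"
      by (simp add: sum_ennreal)
    also have "(\<Sum>i<n. (cmod (a (int_decode i)))\<^sup>2) = (\<Sum>k\<in>int_decode ` {..<n}. (cmod (a k))\<^sup>2)"
      by (simp add: sum.reindex[OF inj])
    also have "ennreal \<dots> \<le> ennreal (T * N)" by (intro ennreal_leI bessel) simp
    finally show "(\<Sum>i<n. ennreal ((cmod (a (int_decode i)))\<^sup>2)) \<le> ennreal (T * N)" .
  qed simp
  finally have upper: "(\<integral>\<^sup>+k. (ennreal (cmod (a k)))\<^sup>2 \<partial>count_space UNIV) \<le> ennreal (T * N)" .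
  have lower: "ennreal (T * N) \<le> (\<integral>\<^sup>+k. (ennreal (cmod (a k)))\<^sup>2 \<partial>count_space UNIV)"
  proof (rule ennreal_le_epsilon)
    fix \<epsilon> :: real assume e: "\<epsilon> > 0"
    obtain p where "trig_poly T p" and p: "(\<integral>\<^sup>+x. (ennreal (cmod (F x - p x)))\<^sup>2 \<partial>?M) \<le> ennreal (\<epsilon> / T)"
      using l2_approximable_L2[OF T F fin] e T unfolding l2_approximable_def by (meson divide_pos_pos)
    then obtain S b where S: "finite S" and pS: "p = (\<lambda>x. \<Sum>k\<in>S. b k * harmonic T k x)"
      unfolding trig_poly_def by blast
    have [measurable]: "p \<in> borel_measurable ?M"
      using \<open>trig_poly T p\<close> by (intro borel_measurable_period borel_measurable_trig_poly)
    note [measurable] = F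
    have "(\<integral>\<^sup>+x. (ennreal (cmod (F x - p x)))\<^sup>2 \<partial>?M) < \<infinity>" using p by (rule le_less_trans) simp
    then have int: "integrable ?M (\<lambda>x. (cmod (F x - p x))\<^sup>2)"
      by (intro L2_period_integrable(1)) measurable
    have "ennreal (LINT x|?M. (cmod (F x - p x))\<^sup>2) \<le> ennreal (\<epsilon> / T)"
      using p nn_integral_eq_integral[OF int] by (simp add: ennreal_power)
    then have small: "(LINT x|?M. (cmod (F x - p x))\<^sup>2) \<le> \<epsilon> / T"
      using e T by (subst (asm) ennreal_le_iff) auto
    have "0 \<le> T * (\<Sum>k\<in>S. (cmod (b k - a k / of_real T))\<^sup>2)" using T by (simp add: sum_nonneg)
    then have "N - (\<Sum>k\<in>S. (cmod (a k))\<^sup>2) / T \<le> \<epsilon> / T"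
      using small err[OF S, of b] unfolding pS by linarith
    then have "N \<le> ((\<Sum>k\<in>S. (cmod (a k))\<^sup>2) + \<epsilon>) / T" by (simp add: add_divide_distrib)
    then have "T * N \<le> (\<Sum>k\<in>S. (cmod (a k))\<^sup>2) + \<epsilon>" using T by (simp add: pos_le_divide_eq mult.commute)
    then have "ennreal (T * N) \<le> ennreal ((\<Sum>k\<in>S. (cmod (a k))\<^sup>2) + \<epsilon>)" by (rule ennreal_leI)
    also have "\<dots> = (\<Sum>k\<in>S. (ennreal (cmod (a k)))\<^sup>2) + ennreal \<epsilon>"
      using e by (simp add: sum_nonneg ennreal_plus ennreal_power)
    also have "(\<Sum>k\<in>S. (ennreal (cmod (a k)))\<^sup>2) = (\<integral>\<^sup>+k. (ennreal (cmod (a k)))\<^sup>2 * indicator S k \<partial>count_space UNIV)"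
      using S by (simp add: nn_integral_count_space_finite flip: nn_integral_count_space_indicator)
    also have "\<dots> \<le> (\<integral>\<^sup>+k. (ennreal (cmod (a k)))\<^sup>2 \<partial>count_space UNIV)"
      by (intro nn_integral_mono) (simp add: indicator_def)
    finally show "ennreal (T * N) \<le> (\<integral>\<^sup>+k. (ennreal (cmod (a k)))\<^sup>2 \<partial>count_space UNIV) + ennreal \<epsilon>"
      by (simp add: add_right_mono)
  qed
  show ?thesis using antisym[OF upper lower] T N0 by (simp add: N ennreal_mult flip: a_def)
qed

section \<open>Summation over the translates of a period\<close>

lemma measurable_translates_of_period [measurable]:
  "(\<lambda>(x, j). x + of_int j * T) \<in> period_measure T \<Otimes>\<^sub>M count_space (UNIV :: int set) \<rightarrow>\<^sub>M lborel"
proof -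
  let ?M = "period_measure T" and ?N = "count_space (UNIV :: int set)"
  have [measurable]: "(\<lambda>x. x) \<in> ?M \<rightarrow>\<^sub>M borel" by (rule borel_measurable_period) simp
  have "fst \<in> ?M \<Otimes>\<^sub>M ?N \<rightarrow>\<^sub>M borel" by (rule measurable_compose[OF measurable_fst]) simp
  moreover have "(\<lambda>z. of_int (snd z) :: real) \<in> ?M \<Otimes>\<^sub>M ?N \<rightarrow>\<^sub>M borel"
    by (rule measurable_compose[OF measurable_snd]) simp
  ultimately show ?thesis by (simp add: case_prod_beta)
qed

lemma pair_sigma_finite_period: "pair_sigma_finite (period_measure T) (count_space (UNIV :: int set))"
proof -
  interpret M: finite_measure "period_measure T" by (rule finite_measure_period)
  interpret N: sigma_finite_measure "count_space (UNIV :: int set)"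
    by (rule sigma_finite_measure_count_space_countable) auto
  show ?thesis ..
qed

text \<open>The line is the disjoint union of the translates of one period, so \<open>(x, j) \<mapsto> x + j T\<close> preserves
  measure.  With this formulation both the summation of a nonnegative function and that of an
  integrable function over the translates are instances of Fubini's theorem.\<close>

lemma distr_translates_of_period:
  assumes T: "T > 0"
  shows "distr (period_measure T \<Otimes>\<^sub>M count_space (UNIV :: int set)) lborel (\<lambda>(x, j). x + of_int j * T) = lborel"
proof (rule measure_eqI)
  let ?M = "period_measure T" and ?N = "count_space (UNIV :: int set)"
  interpret pair_sigma_finite ?M ?N by (rule pair_sigma_finite_period)
  define I where "I j = {of_int j * T ..< (of_int j + 1) * T}" for j :: int
  have I: "y \<in> I j \<longleftrightarrow> j = \<lfloor>y / T\<rfloor>" for y j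
    using T by (auto simp: I_def floor_eq_iff field_simps eq_commute[of j])
  have [measurable]: "I j \<in> sets borel" for j by (simp add: I_def)
  have meas: "(\<lambda>z. fst z + of_int (snd z) * T) \<in> ?M \<Otimes>\<^sub>M ?N \<rightarrow>\<^sub>M borel"
    using measurable_translates_of_period[of T] by (simp add: case_prod_beta)
  fix A assume "A \<in> sets (distr (?M \<Otimes>\<^sub>M ?N) lborel (\<lambda>(x, j). x + of_int j * T))"
  then have A [measurable]: "A \<in> sets borel" by simp
  have "emeasure (distr (?M \<Otimes>\<^sub>M ?N) lborel (\<lambda>(x, j). x + of_int j * T)) A
    = (\<integral>\<^sup>+z. indicator A z \<partial>distr (?M \<Otimes>\<^sub>M ?N) lborel (\<lambda>(x, j). x + of_int j * T))"
    by simp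
  also have "\<dots> = (\<integral>\<^sup>+z. indicator A (fst z + of_int (snd z) * T) \<partial>(?M \<Otimes>\<^sub>M ?N))"
    by (subst nn_integral_distr[OF measurable_translates_of_period]) (auto simp: case_prod_beta)
  also have "\<dots> = (\<integral>\<^sup>+j. \<integral>\<^sup>+x. indicator A (x + of_int j * T) \<partial>?M \<partial>?N)"
    using measurable_compose[OF meas borel_measurable_indicator[OF A, where 'b = ennreal]]
    by (subst nn_integral_snd[symmetric]) (auto simp: case_prod_beta)
  also have "\<dots> = (\<integral>\<^sup>+j. \<integral>\<^sup>+y. indicator A y * indicator (I j) y \<partial>lborel \<partial>?N)"
  proof (rule nn_integral_cong)
    fix j :: int
    have "(\<integral>\<^sup>+y. indicator A y * indicator (I j) y \<partial>lborel)
      = (\<integral>\<^sup>+x. indicator A (of_int j * T + x) * indicator (I j) (of_int j * T + x) \<partial>lborel)"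
      using nn_integral_real_affine[of "\<lambda>y. indicator A y * indicator (I j) y" 1 "of_int j * T"] by simp
    also have "\<dots> = (\<integral>\<^sup>+x. indicator A (x + of_int j * T) * indicator {0..<T} x \<partial>lborel)"
      by (intro nn_integral_cong) (simp add: I_def indicator_def algebra_simps)
    also have "\<dots> = (\<integral>\<^sup>+x. indicator A (x + of_int j * T) \<partial>?M)"
      by (subst nn_integral_restrict_space) auto
    finally show "(\<integral>\<^sup>+x. indicator A (x + of_int j * T) \<partial>?M)
      = (\<integral>\<^sup>+y. indicator A y * indicator (I j) y \<partial>lborel)" by simp
  qed
  also have "\<dots> = (\<integral>\<^sup>+y. \<integral>\<^sup>+j. indicator A y * indicator (I j) y \<partial>?N \<partial>lborel)"
    by (rule nn_integral_count_space_nn_integral[symmetric]) auto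
  also have "\<dots> = (\<integral>\<^sup>+y. indicator A y \<partial>lborel)"
  proof (rule nn_integral_cong)
    fix y :: real
    have "(\<integral>\<^sup>+j. indicator A y * indicator (I j) y \<partial>?N)
      = indicator A y * (\<integral>\<^sup>+j. indicator {\<lfloor>y / T\<rfloor>} j \<partial>?N)"
      by (subst nn_integral_cmult[symmetric]) (auto simp: indicator_def I intro!: nn_integral_cong)
    then show "(\<integral>\<^sup>+j. indicator A y * indicator (I j) y \<partial>?N) = (indicator A y :: ennreal)"
      by simp
  qed
  finally show "emeasure (distr (?M \<Otimes>\<^sub>M ?N) lborel (\<lambda>(x, j). x + of_int j * T)) A = emeasure lborel A"
    by simp
qed simp

lemma borel_measurable_translate:
  assumes "f \<in> borel_measurable borel"
  shows "(\<lambda>(x, j). f (x + of_int j * T)) \<in> borel_measurable (period_measure T \<Otimes>\<^sub>M count_space (UNIV :: int set))"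
proof -
  have "f \<in> lborel \<rightarrow>\<^sub>M borel" using assms by simp
  from measurable_compose[OF measurable_translates_of_period this]
  show ?thesis by (simp add: case_prod_beta)
qed

lemma nn_integral_periodization:
  assumes T: "T > 0" and f: "f \<in> borel_measurable borel"
  shows "(\<integral>\<^sup>+x. \<integral>\<^sup>+j. f (x + of_int j * T) \<partial>count_space (UNIV :: int set) \<partial>period_measure T) = (\<integral>\<^sup>+x. f x \<partial>lborel)"
proof -
  interpret pair_sigma_finite "period_measure T" "count_space (UNIV :: int set)"
    by (rule pair_sigma_finite_period)
  have "(\<integral>\<^sup>+x. f x \<partial>lborel)
    = (\<integral>\<^sup>+z. f (case z of (x, j) \<Rightarrow> x + of_int j * T) \<partial>(period_measure T \<Otimes>\<^sub>M count_space UNIV))"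
    by (subst distr_translates_of_period[OF T, symmetric],
        subst nn_integral_distr[OF measurable_translates_of_period]) (use f in auto)
  also have "\<dots> = (\<integral>\<^sup>+x. \<integral>\<^sup>+j. f (x + of_int j * T) \<partial>count_space UNIV \<partial>period_measure T)"
    using borel_measurable_translate[OF f, of T]
    by (subst M2.nn_integral_fst[symmetric]) (auto simp: case_prod_beta)
  finally show ?thesis by simp
qed

lemma integral_periodization:
  fixes f :: "real \<Rightarrow> complex"
  assumes T: "T > 0" and f: "integrable lborel f"
  shows "(LINT x|period_measure T. LINT j|count_space (UNIV :: int set). f (x + of_int j * T)) = (LINT x|lborel. f x)"
proof -
  interpret pair_sigma_finite "period_measure T" "count_space (UNIV :: int set)"
    by (rule pair_sigma_finite_period)
  let ?P = "period_measure T \<Otimes>\<^sub>M count_space (UNIV :: int set)"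
  have m: "f \<in> borel_measurable lborel" using f by (rule borel_measurable_integrable)
  have "integrable (distr ?P lborel (\<lambda>(x, j). x + of_int j * T)) f"
    unfolding distr_translates_of_period[OF T] by (rule f)
  then have int: "integrable ?P (\<lambda>(x, j). f (x + of_int j * T))"
    by (subst (asm) integrable_distr_eq[OF measurable_translates_of_period])
       (use m in \<open>auto simp: case_prod_beta'\<close>)
  have "(LINT x|lborel. f x) = (LINT z|?P. f (case z of (x, j) \<Rightarrow> x + of_int j * T))"
    by (subst distr_translates_of_period[OF T, symmetric],
        subst integral_distr[OF measurable_translates_of_period]) (use m in auto)
  also have "\<dots> = (LINT x|period_measure T. LINT j|count_space UNIV. f (x + of_int j * T))"
    using integral_fst'[OF int] by (simp add: case_prod_beta')
  finally show ?thesis by simp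
qed

lemma borel_measurable_periodization:
  fixes f :: "real \<Rightarrow> complex"
  assumes f: "f \<in> borel_measurable borel"
  shows "(\<lambda>x. LINT j|count_space (UNIV :: int set). f (x + of_int j * T)) \<in> borel_measurable (period_measure T)"
proof -
  interpret pair_sigma_finite "period_measure T" "count_space (UNIV :: int set)"
    by (rule pair_sigma_finite_period)
  show ?thesis
    by (rule M2.borel_measurable_lebesgue_integral) (use borel_measurable_translate[OF f] in simp)
qed

lemma harmonic_periodic: "T > 0 \<Longrightarrow> harmonic T k (x + of_int j * T) = harmonic T k x"
proof -
  assume "T > 0"
  then have "harmonic T k (x + of_int j * T) = harmonic T k x * cis (2 * pi * of_int (k * j))"
    by (simp add: harmonic_def cis_mult add_divide_distrib algebra_simps)
  then show ?thesis by (simp add: cis_multiple_2pi)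
qed

section \<open>Infinite sums and representatives\<close>

lemma summable_on_from_nn_integral:
  fixes f :: "'a \<Rightarrow> real"
  assumes nn: "\<And>x. f x \<ge> 0" and fin: "(\<integral>\<^sup>+x. ennreal (f x) \<partial>count_space A) < \<infinity>"
  shows "f summable_on A" "ennreal (infsum f A) = (\<integral>\<^sup>+x. ennreal (f x) \<partial>count_space A)"
proof -
  have int: "integrable (count_space A) f"
    by (rule integrableI_bounded) (use nn fin in auto)
  then have abs: "Infinite_Set_Sum.abs_summable_on f A" by (simp add: Infinite_Set_Sum.abs_summable_on_def)
  then show "f summable_on A" by (rule abs_summable_summable[OF abs_summable_equivalent[THEN iffD2]])
  have "infsum f A = (LINT x|count_space A. f x)"
    using infsetsum_infsum[OF abs] by (simp add: infsetsum_def)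
  then show "ennreal (infsum f A) = (\<integral>\<^sup>+x. ennreal (f x) \<partial>count_space A)"
    using nn_integral_eq_integral[OF int] nn by simp
qed

lemma complex_completion_ex_borel_measurable:
  fixes h :: "'a \<Rightarrow> complex"
  assumes "h \<in> borel_measurable (completion M)"
  obtains h' where "h' \<in> borel_measurable M" "AE x in M. h x = h' x"
proof -
  have "(\<lambda>x. Re (h x)) \<in> borel_measurable (completion M)" "(\<lambda>x. Im (h x)) \<in> borel_measurable (completion M)"
    using assms by measurable
  from this[THEN completion_ex_borel_measurable_real] obtain u v where uv: "u \<in> borel_measurable M" "v \<in> borel_measurable M"
      "AE x in M. Re (h x) = u x" "AE x in M. Im (h x) = v x"
    by blast
  show ?thesis
  proof (rule that)
    show "(\<lambda>x. Complex (u x) (v x)) \<in> borel_measurable M"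
      using uv unfolding Complex_eq by measurable
    show "AE x in M. h x = Complex (u x) (v x)"
      using uv(3,4) by eventually_elim (simp add: complex_eq_iff)
  qed
qed

lemma nn_integral_L2:
  assumes "h \<in> L2"
  shows "(\<integral>\<^sup>+x. (ennreal (cmod (h x)))\<^sup>2 \<partial>lebesgue) = ennreal ((L2_norm h)\<^sup>2)"
proof -
  have int: "integrable lebesgue (\<lambda>x. (cmod (h x))\<^sup>2)" using assms by (simp add: L2_def)
  have "(\<integral>\<^sup>+x. (ennreal (cmod (h x)))\<^sup>2 \<partial>lebesgue) = ennreal (LINT x|lebesgue. (cmod (h x))\<^sup>2)"
    using nn_integral_eq_integral[OF int] by (simp add: ennreal_power)
  also have "(LINT x|lebesgue. (cmod (h x))\<^sup>2) = (L2_norm h)\<^sup>2"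
    unfolding L2_norm_def by (subst real_sqrt_pow2) auto
  finally show ?thesis .
qed

lemma norm_integral_le_nn_integral:
  fixes f :: "'a \<Rightarrow> complex"
  shows "ennreal (cmod (LINT x|M. f x)) \<le> (\<integral>\<^sup>+x. ennreal (cmod (f x)) \<partial>M)"
  by (cases "integrable M f") (auto intro: integral_norm_bound_ennreal simp: not_integrable_integral_eq)

section \<open>Gabor coefficients and the frame bounds\<close>

context decreasing_window
begin

text \<open>For fixed \<open>x\<close> this is the row of the sampling matrix with time shift \<open>s\<close>, applied to the values
  of \<open>h\<close> at the points \<open>x + j T\<close>; as a function of \<open>x\<close>, its Fourier coefficients are the Gabor
  coefficients at that time shift.\<close>

definition fiber :: "real \<Rightarrow> (real \<Rightarrow> complex) \<Rightarrow> real \<Rightarrow> real \<Rightarrow> complex" where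
  "fiber T h s x = (LINT j|count_space (UNIV :: int set). h (x + of_int j * T) * of_real (g (x + of_int j * T - s)))"

text \<open>The sum of the squared Gabor coefficients over the lattice of frequencies \<open>k / T\<close>, with values in
  \<open>ennreal\<close> so that it is meaningful before summability is known.\<close>

definition gabor_energy :: "real \<Rightarrow> (int \<Rightarrow> real) \<Rightarrow> (real \<Rightarrow> complex) \<Rightarrow> ennreal" where
  "gabor_energy T \<Lambda> h = (\<integral>\<^sup>+n. \<integral>\<^sup>+k.
      (ennreal (cmod (LINT x|lborel. h x * cnj (time_freq_shift (\<Lambda> n, 1 / T * of_int k) (\<lambda>x. complex_of_real (g x)) x))))\<^sup>2
      \<partial>count_space (UNIV :: int set) \<partial>count_space (UNIV :: int set))"

lemma borel_measurable_fiber: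
  assumes h: "h \<in> borel_measurable borel"
  shows "fiber T h s \<in> borel_measurable (period_measure T)"
proof -
  have "(\<lambda>x. h x * of_real (g (x - s))) \<in> borel_measurable borel" using h by measurable
  from borel_measurable_periodization[OF this, of T] show ?thesis by (simp add: fiber_def[abs_def])
qed

lemma inner_eq_fiber_coefficient:
  assumes T: "T > 0" and h: "h \<in> borel_measurable borel"
    and hfin: "integrable lborel (\<lambda>x. (cmod (h x))\<^sup>2)" and gfin: "integrable lborel (\<lambda>x. (g x)\<^sup>2)"
  shows "(LINT x|lborel. h x * cnj (time_freq_shift (s, 1 / T * of_int k) (\<lambda>x. complex_of_real (g x)) x))
    = (LINT x|period_measure T. fiber T h s x * cnj (harmonic T k x))"
proof -
  note [measurable] = h
  define f where "f x = h x * cnj (time_freq_shift (s, 1 / T * of_int k) (\<lambda>x. complex_of_real (g x)) x)" for x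
  have f: "f x = h x * of_real (g (x - s)) * cnj (harmonic T k x)" for x
    by (simp add: f_def time_freq_shift_def harmonic_def cis_conv_exp mult_ac)
  have gfin': "integrable lborel (\<lambda>x. (g (x - s))\<^sup>2)"
    using lborel_integrable_real_affine[OF gfin, of 1 "- s"] by simp
  have "integrable lborel f"
  proof (rule Bochner_Integration.integrable_bound)
    show "integrable lborel (\<lambda>x. (cmod (h x))\<^sup>2 + (g (x - s))\<^sup>2)" using hfin gfin' by simp
    show "f \<in> borel_measurable lborel" unfolding f[abs_def] cnj_harmonic by measurable
    have "u * v \<le> u\<^sup>2 + v\<^sup>2" if "u \<ge> 0" "v \<ge> 0" for u v :: real
      using zero_le_power2[of "u - v"] mult_nonneg_nonneg[OF that]
      unfolding power2_diff by linarith
    then show "AE x in lborel. norm (f x) \<le> norm ((cmod (h x))\<^sup>2 + (g (x - s))\<^sup>2)"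
      by (intro AE_I2) (simp add: f norm_mult)
  qed
  from integral_periodization[OF T this]
  have "(LINT x|lborel. f x) = (LINT x|period_measure T. LINT j|count_space (UNIV :: int set). f (x + of_int j * T))"
    by simp
  also have "\<dots> = (LINT x|period_measure T. fiber T h s x * cnj (harmonic T k x))"
    unfolding f fiber_def harmonic_periodic[OF T] by (simp add: Bochner_Integration.integral_mult_left_zero)
  finally show ?thesis by (simp add: f_def)
qed

lemma gabor_energy_eq_fibers:
  assumes T: "T > 0" and h: "h \<in> borel_measurable borel"
    and hfin: "integrable lborel (\<lambda>x. (cmod (h x))\<^sup>2)" and gfin: "integrable lborel (\<lambda>x. (g x)\<^sup>2)"
    and fib: "\<And>n. (\<integral>\<^sup>+x. (ennreal (cmod (fiber T h (\<Lambda> n) x)))\<^sup>2 \<partial>period_measure T) < \<infinity>"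
  shows "gabor_energy T \<Lambda> h
    = ennreal T * (\<integral>\<^sup>+x. \<integral>\<^sup>+n. (ennreal (cmod (fiber T h (\<Lambda> n) x)))\<^sup>2 \<partial>count_space UNIV \<partial>period_measure T)"
proof -
  note [measurable] = borel_measurable_fiber[OF h, of T]
  have "gabor_energy T \<Lambda> h
    = (\<integral>\<^sup>+n. ennreal T * (\<integral>\<^sup>+x. (ennreal (cmod (fiber T h (\<Lambda> n) x)))\<^sup>2 \<partial>period_measure T) \<partial>count_space UNIV)"
    unfolding gabor_energy_def inner_eq_fiber_coefficient[OF T h hfin gfin]
    by (intro nn_integral_cong parseval[OF T] borel_measurable_fiber[OF h] fib)
  also have "\<dots> = ennreal T * (\<integral>\<^sup>+n. \<integral>\<^sup>+x. (ennreal (cmod (fiber T h (\<Lambda> n) x)))\<^sup>2 \<partial>period_measure T \<partial>count_space UNIV)"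
    by (simp add: nn_integral_cmult)
  also have "(\<integral>\<^sup>+n. \<integral>\<^sup>+x. (ennreal (cmod (fiber T h (\<Lambda> n) x)))\<^sup>2 \<partial>period_measure T \<partial>count_space UNIV)
    = (\<integral>\<^sup>+x. \<integral>\<^sup>+n. (ennreal (cmod (fiber T h (\<Lambda> n) x)))\<^sup>2 \<partial>count_space UNIV \<partial>period_measure T)"
    by (rule nn_integral_count_space_nn_integral[symmetric]) auto
  finally show ?thesis .
qed

text \<open>The discrete bounds hold at almost every \<open>x\<close>, namely where the values of \<open>h\<close> at the translates of
  \<open>x\<close> are square-summable, with constants independent of \<open>x\<close>; hence they may be integrated over one
  period.\<close>

lemma gabor_energy_bounds:
  fixes \<Lambda> :: "int \<Rightarrow> real"
  assumes T: "T > 0" and \<alpha>: "\<alpha> \<le> T" and mono: "strict_mono \<Lambda>"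
    and gap: "\<And>n. \<Lambda> n + 1 \<le> \<Lambda> (n + int m)" and dense: "\<And>n. \<Lambda> (n + 1) - \<Lambda> n \<le> \<alpha>"
    and L: "L > 0" and gL: "\<And>z. 0 \<le> z \<Longrightarrow> z < \<alpha> \<Longrightarrow> L \<le> g z"
    and gfin: "integrable lborel (\<lambda>x. (g x)\<^sup>2)"
  obtains A B :: real where "A > 0" "B > 0" and
    "\<And>h. h \<in> borel_measurable borel \<Longrightarrow> integrable lborel (\<lambda>x. (cmod (h x))\<^sup>2) \<Longrightarrow>
      ennreal A * (\<integral>\<^sup>+x. (ennreal (cmod (h x)))\<^sup>2 \<partial>lborel)
      \<le> gabor_energy T \<Lambda> h \<and>
      gabor_energy T \<Lambda> h
      \<le> ennreal B * (\<integral>\<^sup>+x. (ennreal (cmod (h x)))\<^sup>2 \<partial>lborel)"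
proof -
  obtain A :: real where A: "A > 0" and Ab: "\<And>x (c :: int \<Rightarrow> complex).
    (\<integral>\<^sup>+k. (ennreal (cmod (c k)))\<^sup>2 \<partial>count_space UNIV) < \<infinity> \<Longrightarrow>
    ennreal A * (\<integral>\<^sup>+k. (ennreal (cmod (c k)))\<^sup>2 \<partial>count_space UNIV)
    \<le> (\<integral>\<^sup>+n. (ennreal (cmod (LINT k|count_space UNIV. c k * of_real (g (x + of_int k * T - \<Lambda> n)))))\<^sup>2 \<partial>count_space UNIV)"
    using analysis_lower_bound[OF T \<alpha> mono gap dense L gL] by blast
  obtain B :: real where B: "B > 0" and Bb: "\<And>x (a :: int \<Rightarrow> ennreal).
    (\<integral>\<^sup>+n. (\<integral>\<^sup>+k. a k * ennreal (g (x + of_int k * T - \<Lambda> n)) \<partial>count_space UNIV)\<^sup>2 \<partial>count_space UNIV)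
     \<le> ennreal B * (\<integral>\<^sup>+k. (a k)\<^sup>2 \<partial>count_space UNIV)"
    using analysis_upper_bound[OF T mono gap] by blast
  let ?M = "period_measure T" and ?N = "count_space (UNIV :: int set)"
  interpret pair_sigma_finite ?M ?N by (rule pair_sigma_finite_period)
  show ?thesis
  proof (rule that[of "T * A" "T * B"])
    show "T * A > 0" "T * B > 0" using T A B by auto
    fix h :: "real \<Rightarrow> complex"
    assume h: "h \<in> borel_measurable borel" and hfin: "integrable lborel (\<lambda>x. (cmod (h x))\<^sup>2)"
    note [measurable] = h
    define H where "H x = (\<integral>\<^sup>+j. (ennreal (cmod (h (x + of_int j * T))))\<^sup>2 \<partial>?N)" for x
    define W where "W x = (\<integral>\<^sup>+n. (ennreal (cmod (fiber T h (\<Lambda> n) x)))\<^sup>2 \<partial>?N)" for x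
    have sqm: "(\<lambda>x. (ennreal (cmod (h x)))\<^sup>2) \<in> borel_measurable borel" by measurable
    have H: "(\<integral>\<^sup>+x. H x \<partial>?M) = (\<integral>\<^sup>+x. (ennreal (cmod (h x)))\<^sup>2 \<partial>lborel)"
      unfolding H_def by (rule nn_integral_periodization[OF T sqm])
    have H_meas [measurable]: "H \<in> borel_measurable ?M"
      unfolding H_def[abs_def]
      using M2.borel_measurable_nn_integral[OF borel_measurable_translate[OF sqm]] by simp
    have "(\<integral>\<^sup>+x. (ennreal (cmod (h x)))\<^sup>2 \<partial>lborel) = (\<integral>\<^sup>+x. ennreal ((cmod (h x))\<^sup>2) \<partial>lborel)"
      by (simp add: ennreal_power)
    also have "\<dots> < \<infinity>" using hfin by (subst nn_integral_eq_integral) auto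
    finally have norm_fin: "(\<integral>\<^sup>+x. (ennreal (cmod (h x)))\<^sup>2 \<partial>lborel) < \<infinity>" .
    then have H_fin: "AE x in ?M. H x < \<infinity>"
      unfolding H[symmetric] using nn_integral_PInf_AE[OF H_meas] by (auto simp: less_top)
    have W_le: "W x \<le> ennreal B * H x" for x
    proof -
      have "ennreal (cmod (fiber T h (\<Lambda> n) x))
          \<le> (\<integral>\<^sup>+k. ennreal (cmod (h (x + of_int k * T))) * ennreal (g (x + of_int k * T - \<Lambda> n)) \<partial>?N)" for n
        unfolding fiber_def by (rule order_trans[OF norm_integral_le_nn_integral]) (simp add: norm_mult ennreal_mult)
      then have "W x \<le> (\<integral>\<^sup>+n. (\<integral>\<^sup>+k. ennreal (cmod (h (x + of_int k * T))) * ennreal (g (x + of_int k * T - \<Lambda> n)) \<partial>?N)\<^sup>2 \<partial>?N)"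
        unfolding W_def by (intro nn_integral_mono power_mono) auto
      also have "\<dots> \<le> ennreal B * H x" unfolding H_def by (rule Bb)
      finally show ?thesis .
    qed
    have W_ge: "ennreal A * H x \<le> W x" if "H x < \<infinity>" for x
      using Ab[of "\<lambda>k. h (x + of_int k * T)" x] that unfolding H_def W_def fiber_def by simp
    have "(\<integral>\<^sup>+x. W x \<partial>?M) \<le> (\<integral>\<^sup>+x. ennreal B * H x \<partial>?M)" by (intro nn_integral_mono W_le)
    also have "\<dots> = ennreal B * (\<integral>\<^sup>+x. H x \<partial>?M)" by (simp add: nn_integral_cmult)
    finally have upper: "(\<integral>\<^sup>+x. W x \<partial>?M) \<le> ennreal B * (\<integral>\<^sup>+x. H x \<partial>?M)" .
    have "ennreal A * (\<integral>\<^sup>+x. H x \<partial>?M) = (\<integral>\<^sup>+x. ennreal A * H x \<partial>?M)" by (simp add: nn_integral_cmult)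
    also have "\<dots> \<le> (\<integral>\<^sup>+x. W x \<partial>?M)"
      using H_fin by (intro nn_integral_mono_AE) (auto elim!: eventually_mono intro: W_ge)
    finally have lower: "ennreal A * (\<integral>\<^sup>+x. H x \<partial>?M) \<le> (\<integral>\<^sup>+x. W x \<partial>?M)" .
    have fib: "(\<integral>\<^sup>+x. (ennreal (cmod (fiber T h (\<Lambda> n) x)))\<^sup>2 \<partial>?M) < \<infinity>" for n
    proof -
      have "(\<integral>\<^sup>+x. (ennreal (cmod (fiber T h (\<Lambda> n) x)))\<^sup>2 \<partial>?M) \<le> (\<integral>\<^sup>+x. W x \<partial>?M)"
        unfolding W_def by (intro nn_integral_mono nn_integral_ge_point) simp
      also have "\<dots> \<le> ennreal B * (\<integral>\<^sup>+x. H x \<partial>?M)" by (rule upper)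
      also have "\<dots> < \<infinity>" using norm_fin by (simp add: H ennreal_mult_less_top)
      finally show ?thesis .
    qed
    show "ennreal (T * A) * (\<integral>\<^sup>+x. (ennreal (cmod (h x)))\<^sup>2 \<partial>lborel)
      \<le> gabor_energy T \<Lambda> h \<and>
      gabor_energy T \<Lambda> h
      \<le> ennreal (T * B) * (\<integral>\<^sup>+x. (ennreal (cmod (h x)))\<^sup>2 \<partial>lborel)"
      unfolding gabor_energy_eq_fibers[OF T h hfin gfin fib] W_def[symmetric] H[symmetric]
      using mult_left_mono[OF lower, of "ennreal T"] mult_left_mono[OF upper, of "ennreal T"] T A B
      by (simp add: ennreal_mult mult.assoc)
  qed
qed

end

theorem theorem1p3:
  fixes \<alpha> \<beta> :: real and g :: "real \<Rightarrow> real" and \<Lambda> :: "int \<Rightarrow> real" and m :: nat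
  assumes "\<alpha> > 0" and "\<beta> > 0" and "\<alpha> * \<beta> \<le> 1"
    and "(\<lambda>x. complex_of_real (g x)) \<in> L2"
    and "\<And>x. x < 0 \<Longrightarrow> g x = 0"
    and "stably_decreasing g"
    and "\<exists>L>0. (g \<longlongrightarrow> L) (at_left \<alpha>)"
    and "\<And>n. 0 < \<Lambda> (n + 1) - \<Lambda> n \<and> \<Lambda> (n + 1) - \<Lambda> n \<le> \<alpha>"
    and "\<And>n. \<Lambda> (n + int m) - \<Lambda> n \<ge> 1"
  shows "gabor_frame (\<lambda>x. complex_of_real (g x)) (range \<Lambda> \<times> range (\<lambda>k::int. \<beta> * of_int k))"
proof -
  let ?g = "\<lambda>x. complex_of_real (g x)" and ?\<Gamma> = "range \<Lambda> \<times> range (\<lambda>k::int. \<beta> * of_int k)"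
  interpret decreasing_window g using assms(5,6) by unfold_locales
  define T where "T = 1 / \<beta>"
  have T: "T > 0" and \<alpha>T: "\<alpha> \<le> T" and \<beta>: "\<beta> = 1 / T"
    using assms(2,3) by (auto simp: T_def field_simps)
  have mono: "strict_mono \<Lambda>"
  proof (rule strict_monoI)
    fix i j :: int assume "i < j"
    then show "\<Lambda> i < \<Lambda> j"
    proof (induction j rule: int_gr_induct)
      case base then show ?case using assms(8)[of i] by simp
    next
      case (step j) then show ?case using assms(8)[of j] by simp
    qed
  qed
  obtain L where L: "L > 0" "(g \<longlongrightarrow> L) (at_left \<alpha>)" using assms(7) by blast
  have gL: "L \<le> g z" if z: "0 \<le> z" "z < \<alpha>" for z
  proof (rule tendsto_upperbound[OF L(2)])
    show "\<forall>\<^sub>F y in at_left \<alpha>. g y \<le> g z"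
      unfolding eventually_at_left[OF z(2)] using z by (intro exI[of _ z]) (auto intro: window_antimono)
  qed simp
  have gfin: "integrable lborel (\<lambda>x. (g x)\<^sup>2)"
  proof -
    have "integrable lebesgue (\<lambda>x. (g x)\<^sup>2)" using assms(4) by (simp add: L2_def)
    then show ?thesis by (subst (asm) integrable_completion) auto
  qed
  have gap: "\<Lambda> n + 1 \<le> \<Lambda> (n + int m)" for n using assms(9)[of n] by simp
  have dense: "\<Lambda> (n + 1) - \<Lambda> n \<le> \<alpha>" for n using assms(8)[of n] by simp
  obtain A B :: real where A: "A > 0" and B: "B > 0" and bounds:
    "\<And>h. h \<in> borel_measurable borel \<Longrightarrow> integrable lborel (\<lambda>x. (cmod (h x))\<^sup>2) \<Longrightarrow>
      ennreal A * (\<integral>\<^sup>+x. (ennreal (cmod (h x)))\<^sup>2 \<partial>lborel)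
      \<le> gabor_energy T \<Lambda> h \<and>
      gabor_energy T \<Lambda> h
      \<le> ennreal B * (\<integral>\<^sup>+x. (ennreal (cmod (h x)))\<^sup>2 \<partial>lborel)"
    using gabor_energy_bounds[OF T \<alpha>T mono gap dense L(1) gL gfin] by blast
  have shift_meas: "time_freq_shift p ?g \<in> borel_measurable borel" for p
    by (cases p) (simp add: time_freq_shift_def)
  have bij: "bij_betw (\<lambda>(n, k). (\<Lambda> n, \<beta> * of_int k)) UNIV ?\<Gamma>"
    using strict_mono_eq[OF mono] assms(2) by (auto simp: bij_betw_def inj_on_def)
  show ?thesis
    unfolding gabor_frame_def
  proof (rule exI[of _ A], intro conjI A, rule exI[of _ B], intro conjI B ballI)
    fix h assume h: "h \<in> L2"
    then have "h \<in> borel_measurable lebesgue" by (simp add: L2_def)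
    (* Inner products and norms only see h up to null sets; a Borel representative allows Fubini. *)
    then obtain h' where h': "h' \<in> borel_measurable lborel" and eq: "AE x in lborel. h x = h' x"
      by (rule complex_completion_ex_borel_measurable)
    have h'b: "h' \<in> borel_measurable borel" using h' by simp
    have eq': "AE x in lebesgue. h x = h' x" using eq by (simp add: AE_completion_iff)
    have h'leb: "h' \<in> borel_measurable lebesgue" using h' by (rule measurable_completion)
    have h'fin: "integrable lborel (\<lambda>x. (cmod (h' x))\<^sup>2)"
    proof -
      have "integrable lebesgue (\<lambda>x. (cmod (h x))\<^sup>2)" using h by (simp add: L2_def)
      then have "integrable lebesgue (\<lambda>x. (cmod (h' x))\<^sup>2)"
        by (rule integrable_cong_AE_imp) (use h'leb eq' in \<open>auto elim!: eventually_mono\<close>)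
      then show ?thesis using h' by (subst (asm) integrable_completion) auto
    qed
    have norm_eq: "(\<integral>\<^sup>+x. (ennreal (cmod (h' x)))\<^sup>2 \<partial>lborel) = ennreal ((L2_norm h)\<^sup>2)"
    proof -
      have "(\<integral>\<^sup>+x. (ennreal (cmod (h' x)))\<^sup>2 \<partial>lborel) = (\<integral>\<^sup>+x. (ennreal (cmod (h x)))\<^sup>2 \<partial>lborel)"
        using eq by (intro nn_integral_cong_AE) (auto elim!: eventually_mono)
      then show ?thesis using nn_integral_L2[OF h] by (simp add: nn_integral_completion)
    qed
    have inner_eq: "L2_inner h (time_freq_shift p ?g) = (LINT x|lborel. h' x * cnj (time_freq_shift p ?g x))" for p
    proof -
      have m: "(\<lambda>x. cnj (time_freq_shift p ?g x)) \<in> borel_measurable borel"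
        using shift_meas[of p] by (rule borel_measurable_continuous_on[rotated]) (intro continuous_intros)
      have m': "(\<lambda>x. cnj (time_freq_shift p ?g x)) \<in> borel_measurable lebesgue"
        using m by (intro measurable_completion) simp
      have "L2_inner h (time_freq_shift p ?g) = (LINT x|lebesgue. h' x * cnj (time_freq_shift p ?g x))"
        unfolding L2_inner_def
      proof (rule integral_cong_AE)
        show "(\<lambda>x. h x * cnj (time_freq_shift p ?g x)) \<in> borel_measurable lebesgue"
          using \<open>h \<in> borel_measurable lebesgue\<close> m' by (rule borel_measurable_times)
        show "(\<lambda>x. h' x * cnj (time_freq_shift p ?g x)) \<in> borel_measurable lebesgue"
          using h'leb m' by (rule borel_measurable_times)
        show "AE x in lebesgue. h x * cnj (time_freq_shift p ?g x) = h' x * cnj (time_freq_shift p ?g x)"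
          using eq' by (auto elim!: eventually_mono)
      qed
      also have "\<dots> = (LINT x|lborel. h' x * cnj (time_freq_shift p ?g x))"
        using borel_measurable_times[OF h'b m] by (intro integral_completion) simp
      finally show ?thesis .
    qed
    let ?F = "\<lambda>p. (cmod (L2_inner h (time_freq_shift p ?g)))\<^sup>2"
    have "(\<integral>\<^sup>+p. ennreal (?F p) \<partial>count_space ?\<Gamma>)
        = (\<integral>\<^sup>+z. ennreal (?F ((\<lambda>(n, k). (\<Lambda> n, \<beta> * of_int k)) z)) \<partial>count_space UNIV)"
      by (rule nn_integral_bij_count_space[OF bij, symmetric])
    also have "\<dots> = (\<integral>\<^sup>+n. \<integral>\<^sup>+k. ennreal (?F (\<Lambda> n, \<beta> * of_int k)) \<partial>count_space UNIV \<partial>count_space UNIV)"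
      by (subst nn_integral_fst_count_space[symmetric]) simp
    finally have S: "(\<integral>\<^sup>+p. ennreal (?F p) \<partial>count_space ?\<Gamma>)
      = gabor_energy T \<Lambda> h'"
      by (simp add: inner_eq \<beta> gabor_energy_def ennreal_power)
    have lower: "ennreal (A * (L2_norm h)\<^sup>2) \<le> (\<integral>\<^sup>+p. ennreal (?F p) \<partial>count_space ?\<Gamma>)"
      and upper: "(\<integral>\<^sup>+p. ennreal (?F p) \<partial>count_space ?\<Gamma>) \<le> ennreal (B * (L2_norm h)\<^sup>2)"
      using bounds[OF h'b h'fin] A B unfolding S norm_eq by (simp_all add: ennreal_mult)
    have fin: "(\<integral>\<^sup>+p. ennreal (?F p) \<partial>count_space ?\<Gamma>) < \<infinity>"
      using upper by (rule le_less_trans) simp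
    have nn: "?F p \<ge> 0" for p by simp
    note sum = summable_on_from_nn_integral[OF nn fin]
    show "?F summable_on ?\<Gamma>" by (rule sum(1))
    have inf0: "0 \<le> infsum ?F ?\<Gamma>" by (rule infsum_nonneg) simp
    show "A * (L2_norm h)\<^sup>2 \<le> infsum ?F ?\<Gamma>"
      using lower inf0 unfolding sum(2)[symmetric] by (subst (asm) ennreal_le_iff) auto
    show "infsum ?F ?\<Gamma> \<le> B * (L2_norm h)\<^sup>2"
      using upper B unfolding sum(2)[symmetric] by (subst (asm) ennreal_le_iff) auto
  qed
qed

end
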